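(* Let $N\ge1$ be an integer, let $\{m_j\}_{j=1}^\infty$ be a strictly increasing sequence of positive integers, and let $j_0\geq 1$ be an integer such that $m_j\le N$ whenever $j\le j_0$. With $V_j$, $X'=\{\xi_{lm}^N\}$, $\mu_N$ and $\varphi_j(\cdot,\xi_{lm}^N)$ as defined in the context, the following hold for every $j\geq 1$ (restricted where indicated) and every $\xi_{lm}^N\in X'$. 1. (Reproducing property) If $j\le j_0$, then for all $f\in V_j$, $\langle f,\varphi_j(\cdot,\xi_{lm}^N)\rangle=f(\xi_{lm}^N)$ and $\langle f,\varphi_j(\cdot,\xi_{lm}^N)\rangle_X=f(\xi_{lm}^N)$. 2. $\|\varphi_j(\cdot,\xi_{lm}^N)\|=m_j$, $\varphi_j(\xi_{lm}^N,\xi_{lm}^N)=m_j^2$, and, for $j\le j_0$, $\|\varphi_j(\cdot,\xi_{lm}^N)\|_X=m_j$. 3. $\varphi_j(\cdot,\xi_{lm}^N)$ is localized around $\xi_{lm}^N$, i.e. $$\frac{\|\varphi_j(\cdot,\xi_{lm}^N)\|}{\varphi_j(\xi_{lm}^N,\xi_{lm}^N)}=\min\{\|f\|: f\in V_j,\ f(\xi_{lm}^N)=1\}.$$ 4. If $j\le j_0$, then $\operatorname{span}\{\varphi_j(\cdot,\xi_{lm}^N):\xi_{lm}^N\in X'\}=V_j$. 5. If $j\le j_0$, the set $\{\sqrt{\mu_N(\xi_{lm}^N)}\,\varphi_j(\cdot,\xi_{lm}^N):\xi_{lm}^N\in X'\}$ is a tight frame in $V_j$, i.e. for every $f\in V_j$,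 $$\|f\|^2=\sum_{l=1}^N\sum_{m=0}^{2N}\mu_N(\xi_{lm}^N)\,|\langle f,\varphi_j(\cdot,\xi_{lm}^N)\rangle|^2.$$ 6. $\int_{\mathbb{S}^2}\varphi_j(\xi,\xi_{lm}^N)\,d\omega(\xi)=1$, and, if $m_j\le N$, $\int_X\varphi_j(\xi,\xi_{lm}^N)\,d\mu_N(\xi)=1$.
   Context: $\mathbb{S}^2$ is the unit sphere in $\mathbb{R}^3$, with points written $(\sin\theta\cos\varphi,\sin\theta\sin\varphi,\cos\theta)$, $\theta\in[0,\pi]$, $\varphi\in[0,2\pi]$; functions on $\mathbb{S}^2$ are identified with functions of $(\theta,\varphi)$. The normalized integral is $\int_{\mathbb{S}^2}f\,d\omega=\frac1{4\pi}\int_0^{2\pi}\int_0^\pi f(\theta,\varphi)\sin\theta\,d\theta\,d\varphi$, with scalar product $\langle f,g\rangle=\int_{\mathbb{S}^2}f\,\overline g\,d\omega$ and norm $\|f\|=\langle f,f\rangle^{1/2}$ on $L^2(\mathbb{S}^2)$ (complex-valued functions). Spherical functions: for $n\ge 0$ and $-n\le k\le n$, $Y_{nk}(\theta,\varphi)=\sqrt{2n+1}\,P_n^{|k|}(\cos\theta)e^{ik\varphi}$, where $P_n$ is the Legendre polynomial of degree $n$ (with $P_n(1)=1$) and $P_n^{|k|}(x)=\sqrt{\frac{(n-|k|)!}{(n+|k|)!}}\,(1-x^2)^{|k|/2}\frac{d^{|k|}}{dx^{|k|}}P_n(x)$, normalized so that the $Y_{nk}$ are orthonormal for $\langle\cdot,\cdot\rangle$.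 $\mathcal{H}_n=\operatorname{span}\{Y_{nk}:-n\le k\le n\}$ is the space of spherical harmonics of degree $n$. Nodal points and weights: let $\lambda_1^N,\dots,\lambda_N^N\in(-1,1)$ be the roots of $P_N$, let $l_k^N$ be the Lagrange fundamental polynomials of degree $N-1$ with $l_k^N(\lambda_i^N)=\delta_{ki}$, and let $\mathcal{A}_k^N=\int_{-1}^1 l_k^N(x)\,dx>0$. Put $\theta_l=\arccos\lambda_l^N$ ($1\le l\le N$), $\varphi_m=\frac{2\pi m}{2N+1}$ ($0\le m\le 2N$), $\xi_{lm}^N=(\sin\theta_l\cos\varphi_m,\sin\theta_l\sin\varphi_m,\cos\theta_l)$, $X'=\{\xi_{lm}^N:1\le l\le N,\ 0\le m\le 2N\}$ (identified with $X=\{(\theta_l,\varphi_m)\}$), and $\mu_N(\xi_{lm}^N)=\frac{\mathcal{A}_l^N}{2(2N+1)}$. The discrete integral is $\int_X F\,d\mu_N=\sum_{l=1}^N\sum_{m=0}^{2N}F(\xi_{lm}^N)\mu_N(\xi_{lm}^N)$, with $\langle f,g\rangle_X=\int_X f\,\overline g\,d\mu_N$ and $\|f\|_X=\langle f,f\rangle_X^{1/2}$. Spaces and weighted scaling functions: $V_j=\bigoplus_{n=0}^{m_j-1}\mathcal{H}_n$ (finite-dimensional, consisting of continuous functions), and $$\varphi_j(\xi,\eta)=\sum_{n=0}^{m_j-1}\sum_{k=-n}^n\overline{Y_{nk}(\eta)}\,Y_{nk}(\xi)=\sum_{n=0}^{m_j-1}(2n+1)P_n(\xi\cdot\eta),\qquad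 \xi,\eta\in\mathbb{S}^2.$$ *)

theory Defs
  imports
    "HOL-Analysis.Analysis"
    "HOL-Computational_Algebra.Polynomial"
    "HOL-Library.Function_Algebras"
begin

typedef S2 = "sphere (0 :: real ^ 3) 1"
  by (rule exI[of _ "axis 1 1"]) (simp add: norm_axis_1)

definition sph_point :: "real \<Rightarrow> real \<Rightarrow> S2" where
  "sph_point \<theta> \<phi> = Abs_S2 (vector [sin \<theta> * cos \<phi>, sin \<theta> * sin \<phi>, cos \<theta>])"

definition polar :: "S2 \<Rightarrow> real" where
  "polar \<xi> = arccos (Rep_S2 \<xi> $ 3)"

text \<open>The azimuth lies in the half-open interval from \<open>0\<close> to \<open>2\<pi>\<close>. At the two poles, where it is
  not determined by the point, it is \<open>0\<close>; lemma \<open>sph_Y_sph_point\<close> below shows that this choice has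
  no influence on the spherical functions.\<close>

definition azimuth :: "S2 \<Rightarrow> real" where
  "azimuth \<xi> = Arg2pi (Complex (Rep_S2 \<xi> $ 1) (Rep_S2 \<xi> $ 2))"

lemma Rep_sph_point:
  "Rep_S2 (sph_point \<theta> \<phi>) = vector [sin \<theta> * cos \<phi>, sin \<theta> * sin \<phi>, cos \<theta>]"
proof -
  have "(sin \<theta> * cos \<phi>)\<^sup>2 + (sin \<theta> * sin \<phi>)\<^sup>2 + (cos \<theta>)\<^sup>2
      = (sin \<theta>)\<^sup>2 * ((cos \<phi>)\<^sup>2 + (sin \<phi>)\<^sup>2) + (cos \<theta>)\<^sup>2"
    by (simp only: power_mult_distrib distrib_left)
  also have "\<dots> = 1"
    by simp
  finally have "norm (vector [sin \<theta> * cos \<phi>, sin \<theta> * sin \<phi>, cos \<theta>] :: real ^ 3) = 1"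
    by (simp add: norm_vec_def L2_set_def sum_3)
  thus ?thesis
    unfolding sph_point_def by (subst Abs_S2_inverse) auto
qed

lemma sph_point_polar_azimuth: "sph_point (polar \<xi>) (azimuth \<xi>) = \<xi>"
proof -
  define x y z where "x = Rep_S2 \<xi> $ 1" and "y = Rep_S2 \<xi> $ 2" and "z = Rep_S2 \<xi> $ 3"
  have "norm (Rep_S2 \<xi>) = 1"
    using Rep_S2[of \<xi>] by simp
  hence eq: "x\<^sup>2 + y\<^sup>2 + z\<^sup>2 = 1"
    by (simp add: norm_vec_def L2_set_def sum_3 x_def y_def z_def)
  hence "z\<^sup>2 \<le> 1"
    using zero_le_power2[of x] zero_le_power2[of y] by linarith
  hence z: "-1 \<le> z" "z \<le> 1"
    by (auto simp: abs_square_le_1 abs_le_iff)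
  have c: "cos (polar \<xi>) = z"
    using z by (simp add: polar_def z_def)
  have s: "sin (polar \<xi>) = cmod (Complex x y)"
    using z eq by (simp add: polar_def z_def[symmetric] sin_arccos cmod_def algebra_simps)
  have "Complex x y = of_real (cmod (Complex x y)) * exp (\<i> * of_real (azimuth \<xi>))"
    unfolding azimuth_def x_def y_def by (rule Arg2pi_eq)
  hence "Re (Complex x y) = cmod (Complex x y) * cos (azimuth \<xi>)"
    and "Im (Complex x y) = cmod (Complex x y) * sin (azimuth \<xi>)"
    by (metis Arg2pi_eq cis.sel(1) cis_conv_exp rcis_def Re_rcis,
        metis Arg2pi_eq cis.sel(2) cis_conv_exp rcis_def Im_rcis)
  hence "Rep_S2 (sph_point (polar \<xi>) (azimuth \<xi>)) = Rep_S2 \<xi>"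
    unfolding Rep_sph_point by (simp add: vec_eq_iff forall_3 c s x_def y_def z_def)
  thus ?thesis
    by (simp add: Rep_S2_inject)
qed

definition sph_integral :: "(S2 \<Rightarrow> complex) \<Rightarrow> complex" where
  "sph_integral f = 1 / (4 * of_real pi) *
     (LBINT \<phi>:{0..2*pi}. LBINT \<theta>:{0..pi}. f (sph_point \<theta> \<phi>) * of_real (sin \<theta>))"

definition sph_inner :: "(S2 \<Rightarrow> complex) \<Rightarrow> (S2 \<Rightarrow> complex) \<Rightarrow> complex" where
  "sph_inner f g = sph_integral (\<lambda>\<xi>. f \<xi> * cnj (g \<xi>))"

text \<open>The scalar product of a function with itself is a nonnegative real number.\<close>

definition sph_norm :: "(S2 \<Rightarrow> complex) \<Rightarrow> real" where
  "sph_norm f = sqrt (Re (sph_inner f f))"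

text \<open>The Legendre polynomials, by Rodrigues' formula.\<close>

definition legendre :: "nat \<Rightarrow> real poly" where
  "legendre n = smult (1 / (2 ^ n * fact n)) ((pderiv ^^ n) ([:-1, 0, 1:] ^ n))"

text \<open>\<open>(1 - x\<^sup>2)\<close> to the power \<open>k/2\<close> is written with \<open>sqrt\<close> because \<open>0 powr 0 = 0\<close>.\<close>

definition assoc_legendre :: "nat \<Rightarrow> nat \<Rightarrow> real \<Rightarrow> real" where
  "assoc_legendre n k x =
     sqrt (fact (n - k) / fact (n + k)) * sqrt (1 - x\<^sup>2) ^ k * poly ((pderiv ^^ k) (legendre n)) x"

definition sph_Y :: "nat \<Rightarrow> int \<Rightarrow> S2 \<Rightarrow> complex" where
  "sph_Y n k \<xi> = of_real (sqrt (2 * real n + 1) * assoc_legendre n (nat \<bar>k\<bar>) (cos (polar \<xi>)))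
             * exp (\<i> * of_int k * of_real (azimuth \<xi>))"

lemma sph_Y_sph_point:
  assumes "0 \<le> \<theta>" "\<theta> \<le> pi"
  shows "sph_Y n k (sph_point \<theta> \<phi>) =
    of_real (sqrt (2 * real n + 1) * assoc_legendre n (nat \<bar>k\<bar>) (cos \<theta>))
      * exp (\<i> * of_int k * of_real \<phi>)"
proof -
  have polar: "polar (sph_point \<theta> \<phi>) = \<theta>"
    using assms by (simp add: polar_def Rep_sph_point arccos_cos)
  have "sin \<theta> \<ge> 0"
    using assms by (simp add: sin_ge_zero)
  show ?thesis
  proof (cases "sin \<theta> = 0 \<and> k \<noteq> 0")
    case True
    hence "sqrt (1 - (cos \<theta>)\<^sup>2) = 0" "nat \<bar>k\<bar> \<noteq> 0"
      using sin_squared_eq[of \<theta>] by auto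
    hence "assoc_legendre n (nat \<bar>k\<bar>) (cos \<theta>) = 0"
      unfolding assoc_legendre_def by (simp add: power_0_left)
    thus ?thesis
      unfolding sph_Y_def polar by simp
  next
    case False
    have "exp (\<i> * of_int k * of_real (azimuth (sph_point \<theta> \<phi>)))
        = exp (\<i> * of_int k * of_real \<phi>)"
    proof (cases "k = 0")
      case k: False
      with False \<open>sin \<theta> \<ge> 0\<close> have pos: "sin \<theta> > 0"
        by auto
      define w where "w = Complex (sin \<theta> * cos \<phi>) (sin \<theta> * sin \<phi>)"
      have w: "w = of_real (sin \<theta>) * exp (\<i> * of_real \<phi>)"
        unfolding w_def by (simp add: complex_eq_iff Re_exp Im_exp)
      have "norm w = sin \<theta>"
        unfolding w using pos by (simp add: norm_mult)
      hence "w = of_real (sin \<theta>) * exp (\<i> * of_real (Arg2pi w))"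
        using Arg2pi_eq[of w] by simp
      hence "exp (\<i> * of_real (Arg2pi w)) = exp (\<i> * of_real \<phi>)"
        using w pos by simp
      moreover have "azimuth (sph_point \<theta> \<phi>) = Arg2pi w"
        by (simp add: azimuth_def Rep_sph_point w_def)
      moreover have "exp (\<i> * of_int k * of_real t) = exp (\<i> * of_real t) powi k" for t :: real
        by (simp add: exp_power_int mult_ac)
      ultimately show ?thesis
        by simp
    qed simp
    thus ?thesis
      unfolding sph_Y_def polar by simp
  qed
qed

interpretation cfun: vector_space "\<lambda>(c :: complex) (f :: 'a \<Rightarrow> complex) x. c * f x"
  by unfold_locales (auto simp: fun_eq_iff algebra_simps)

definition sph_harmonics :: "nat \<Rightarrow> (S2 \<Rightarrow> complex) set" where
  "sph_harmonics n = cfun.span {sph_Y n k | k. - int n \<le> k \<and> k \<le> int n}"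

text \<open>The sum of the first \<open>M\<close> spaces of spherical harmonics. It is direct because the functions
  \<open>sph_Y n k\<close> are orthonormal.\<close>

definition harmonic_space :: "nat \<Rightarrow> (S2 \<Rightarrow> complex) set" where
  "harmonic_space M = {\<Sum>n<M. h n | h. \<forall>n<M. h n \<in> sph_harmonics n}"

definition scaling_fun :: "nat \<Rightarrow> S2 \<Rightarrow> S2 \<Rightarrow> complex" where
  "scaling_fun M \<xi> \<eta> = (\<Sum>n<M. \<Sum>k = - int n..int n. cnj (sph_Y n k \<eta>) * sph_Y n k \<xi>)"

text \<open>For \<open>1 \<le> l \<le> N\<close>, the \<open>l\<close>-th of the \<open>N\<close> roots of \<open>legendre N\<close> in increasing order. All of
  these roots are simple and lie strictly between \<open>-1\<close> and \<open>1\<close>.\<close>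

definition legendre_root :: "nat \<Rightarrow> nat \<Rightarrow> real" where
  "legendre_root N l = sorted_list_of_set {x. poly (legendre N) x = 0} ! (l - 1)"

definition lagrange_basis :: "nat \<Rightarrow> nat \<Rightarrow> real poly" where
  "lagrange_basis N k = (\<Prod>i\<in>{1..N} - {k}.
     smult (1 / (legendre_root N k - legendre_root N i)) [:- legendre_root N i, 1:])"

definition gauss_weight :: "nat \<Rightarrow> nat \<Rightarrow> real" where
  "gauss_weight N k = (LBINT x:{-1..1}. poly (lagrange_basis N k) x)"

definition node :: "nat \<Rightarrow> nat \<Rightarrow> nat \<Rightarrow> S2" where
  "node N l i = sph_point (arccos (legendre_root N l)) (2 * pi * real i / (2 * real N + 1))"

definition nodes :: "nat \<Rightarrow> S2 set" where
  "nodes N = {node N l i | l i. l \<in> {1..N} \<and> i \<in> {0..2*N}}"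

text \<open>The weight of \<open>node N l i\<close>, which does not depend on \<open>i\<close>.\<close>

definition node_weight :: "nat \<Rightarrow> nat \<Rightarrow> real" where
  "node_weight N l = gauss_weight N l / (2 * (2 * real N + 1))"

definition disc_integral :: "nat \<Rightarrow> (S2 \<Rightarrow> complex) \<Rightarrow> complex" where
  "disc_integral N F = (\<Sum>l=1..N. \<Sum>i=0..2*N. F (node N l i) * of_real (node_weight N l))"

definition disc_inner :: "nat \<Rightarrow> (S2 \<Rightarrow> complex) \<Rightarrow> (S2 \<Rightarrow> complex) \<Rightarrow> complex" where
  "disc_inner N f g = disc_integral N (\<lambda>\<xi>. f \<xi> * cnj (g \<xi>))"

definition disc_norm :: "nat \<Rightarrow> (S2 \<Rightarrow> complex) \<Rightarrow> real" where
  "disc_norm N f = sqrt (Re (disc_inner N f f))"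

definition is_minimum :: "real \<Rightarrow> real set \<Rightarrow> bool" where
  "is_minimum r A \<longleftrightarrow> r \<in> A \<and> (\<forall>s\<in>A. r \<le> s)"

text \<open>A frame is a family and not a set: distinct indices may carry the same function (for instance,
  \<open>scaling_fun 1\<close> is constant) and must be counted separately.\<close>

definition tight_frame :: "(S2 \<Rightarrow> complex) set \<Rightarrow> 'i set \<Rightarrow> ('i \<Rightarrow> S2 \<Rightarrow> complex) \<Rightarrow> bool" where
  "tight_frame W I g \<longleftrightarrow> finite I \<and> (\<forall>i\<in>I. g i \<in> W) \<and>
     (\<exists>A>0. \<forall>f\<in>W. (\<Sum>i\<in>I. (cmod (sph_inner f (g i)))\<^sup>2) = A * (sph_norm f)\<^sup>2)"

end

theory Submission
  imports Defs
begin

text \<open>Everything follows from two orthonormality relations for the \<open>sph_Y n k\<close>, continuous and discrete,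
  together with \<open>scaling_fun M \<eta> \<eta> = M\<^sup>2\<close>: in coordinates with respect to an orthonormal basis,
  \<open>scaling_fun M\<close> is the reproducing kernel of \<open>harmonic_space M\<close>, and the minimum property is the
  Cauchy-Schwarz inequality. The Legendre equation, differentiated \<open>k\<close> times, reduces orthogonality
  in \<open>\<theta>\<close> to that of the Legendre polynomials themselves by integration by parts, and makes the diagonal
  sum in the addition theorem a constant. Integrating that sum yields the norms of the Legendre
  polynomials. For \<open>M \<le> N\<close> the discrete relation is Gauss quadrature in \<open>cos \<theta>\<close>, exact up to degree
  \<open>2 N - 1\<close>, combined with the vanishing of sums of powers of a nontrivial root of unity of order dividing
  \<open>2 N + 1\<close>.\<close>

section \<open>Legendre polynomials and the diagonal addition theorem\<close>

abbreviation legendre_deriv :: "nat \<Rightarrow> nat \<Rightarrow> real poly" where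
  "legendre_deriv n k \<equiv> (pderiv ^^ k) (legendre n)"

text \<open>The power \<open>u\<close> solves the first-order equation
  \<open>W * u' = 2 n x u\<close> with \<open>W = x^2 - 1\<close>. Differentiating it once gives the
  case \<open>k = 0\<close>, and each further differentiation raises \<open>k\<close> by
  one.\<close>

lemma rodrigues_recurrence:
  fixes n k :: nat and x :: real
  defines "u \<equiv> [:-1, 0, 1:] ^ n"
  shows "(x\<^sup>2 - 1) * poly ((pderiv ^^ (k + 2)) u) x =
    2 * (real n - real k - 1) * x * poly ((pderiv ^^ (k + 1)) u) x +
    (real k + 1) * (2 * real n - real k) * poly ((pderiv ^^ k) u) x"
proof -
  define W X :: "real poly" where "W = [:-1, 0, 1:]" and "X = [:0, 1:]"
  have W: "poly W x = x\<^sup>2 - 1" "poly (pderiv W) x = 2 * x" for x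
    by (simp_all add: W_def pderiv_pCons power2_eq_square)
  have X: "poly X x = x" "poly (pderiv X) x = 1" for x
    by (simp_all add: X_def pderiv_pCons)
  have base: "W * pderiv u = smult (2 * real n) (X * u)"
  proof (cases n)
    case (Suc l)
    have "pderiv W = smult 2 X"
      by (simp add: W_def X_def pderiv_pCons)
    thus ?thesis
      unfolding u_def Suc pderiv_power_Suc W_def[symmetric] by (simp add: algebra_simps)
  qed (simp add: u_def)
  have "W * (pderiv ^^ (k + 2)) u =
      smult (2 * (real n - real k - 1)) (X * (pderiv ^^ (k + 1)) u) +
      smult ((real k + 1) * (2 * real n - real k)) ((pderiv ^^ k) u)" for k
  proof (induction k)
    case 0
    from arg_cong[OF base, of "\<lambda>p. poly (pderiv p) x" for x]
    show ?case
      by (subst poly_eq_poly_eq_iff [symmetric], intro ext)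
         (simp add: pderiv_mult pderiv_smult W X algebra_simps)
  next
    case (Suc k)
    from arg_cong[OF Suc, of "\<lambda>p. poly (pderiv p) x" for x]
    show ?case
      by (subst poly_eq_poly_eq_iff [symmetric], intro ext)
         (simp add: pderiv_mult pderiv_smult pderiv_add W X algebra_simps)
  qed
  from arg_cong[OF this, of "\<lambda>p. poly p x"] show ?thesis
    by (simp add: W X algebra_simps)
qed

text \<open>This is \<open>rodrigues_recurrence\<close> at order \<open>k + n\<close>, rescaled by
  the factor in Rodrigues' formula with its sign reversed; the last coefficient then factors as
  \<open>(n + k + 1) * (n - k)\<close>. The case \<open>k = 0\<close> is Legendre's
  equation.\<close>

lemma legendre_ode:
  "(1 - x\<^sup>2) * poly (legendre_deriv n (k + 2)) x =
    2 * (real k + 1) * x * poly (legendre_deriv n (k + 1)) x -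
    (real n + real k + 1) * (real n - real k) * poly (legendre_deriv n k) x"
proof -
  have shift: "legendre_deriv n i =
      smult (1 / (2 ^ n * fact n)) ((pderiv ^^ (i + n)) ([:-1, 0, 1:] ^ n))" for i
    by (simp add: legendre_def higher_pderiv_smult funpow_add)
  have "(pderiv ^^ (k + 2 + n)) p = (pderiv ^^ (k + n + 2)) p"
       "(pderiv ^^ (k + 1 + n)) p = (pderiv ^^ (k + n + 1)) p" for p :: "real poly"
    by (simp_all add: add_ac)
  moreover define c :: real where "c = 1 / (2 ^ n * fact n)"
  ultimately show ?thesis
    using arg_cong[OF rodrigues_recurrence[of x "k + n" n], of "\<lambda>t. - c * t"]
    unfolding shift c_def[symmetric] by (simp only: poly_smult) (simp add: algebra_simps)
qed

lemma degree_legendre: "degree (legendre n) = n"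
  by (simp add: legendre_def degree_higher_pderiv degree_power_eq)

lemma legendre_deriv_eq_0: "k > n \<Longrightarrow> legendre_deriv n k = 0"
proof -
  assume "k > n"
  have "degree (legendre_deriv n n) = 0"
    by (simp add: degree_higher_pderiv degree_legendre)
  then obtain c where "legendre_deriv n n = [:c:]"
    by (metis degree_eq_zeroE)
  hence "legendre_deriv n (Suc n) = 0"
    by (simp add: pderiv_pCons)
  moreover obtain d where "k = d + Suc n"
    using \<open>k > n\<close> by (metis Suc_leI add.commute le_Suc_ex)
  ultimately show ?thesis
    by (simp only: funpow_add o_apply higher_pderiv_0)
qed

text \<open>Each derivative lowers the guaranteed order of the zero at \<open>a\<close> by one. The
  exponent \<open>i\<close> stays arbitrary because the induction step uses the hypothesis at
  \<open>Suc i\<close>. The lemma serves both the value of \<open>legendre n\<close> at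
  \<open>1\<close> and the zeros at the endpoints of the derivatives in Rodrigues' formula.\<close>

lemma poly_higher_pderiv_power_mult:
  fixes q :: "real poly"
  shows "\<exists>r. (pderiv ^^ k) ([:-a, 1:] ^ (i + k) * q) = [:-a, 1:] ^ i * r \<and>
    poly r a = fact (i + k) / fact i * poly q a"
proof (induction k arbitrary: i)
  case (Suc k)
  obtain r where r: "(pderiv ^^ k) ([:-a, 1:] ^ (Suc i + k) * q) = [:-a, 1:] ^ Suc i * r"
    "poly r a = fact (Suc i + k) / fact (Suc i) * poly q a"
    using Suc[of "Suc i"] by blast
  have "(pderiv ^^ Suc k) ([:-a, 1:] ^ (i + Suc k) * q) = pderiv ([:-a, 1:] ^ Suc i * r)"
    using r(1) by simp
  also have "\<dots> = [:-a, 1:] ^ i * (smult (real (Suc i)) r + [:-a, 1:] * pderiv r)"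
    unfolding pderiv_mult pderiv_power_Suc by (simp add: pderiv_pCons algebra_simps)
  finally show ?case
    by (intro exI conjI, assumption) (simp add: r(2) divide_simps)
qed auto

text \<open>At \<open>1\<close> only the term with all derivatives on \<open>(x - 1)^n\<close>
  survives. It equals \<open>fact n * 2 ^ n\<close>, which the factor in Rodrigues' formula
  cancels.\<close>

lemma poly_legendre_1: "poly (legendre n) 1 = 1"
proof -
  have "[:-1, 0, 1:] ^ n = [:-1, 1:] ^ n * [:1, 1 :: real:] ^ n"
    by (simp flip: power_mult_distrib)
  moreover obtain r where "(pderiv ^^ n) ([:-1, 1:] ^ (0 + n) * [:1, 1:] ^ n) = [:-1, 1:] ^ 0 * r"
    "poly r 1 = fact (0 + n) / fact 0 * poly ([:1, 1:] ^ n) (1 :: real)"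
    using poly_higher_pderiv_power_mult by metis
  ultimately show ?thesis
    by (simp add: legendre_def)
qed

lemma legendre_nonzero [simp]: "legendre n \<noteq> 0"
  using poly_legendre_1[of n] by auto

text \<open>The self-adjoint form of \<open>legendre_ode\<close>: the weight absorbs the first-order
  term. Integration by parts and the telescoping in the diagonal addition theorem both rest on
  it.\<close>

lemma pderiv_weighted_legendre_deriv:
  "pderiv ([:1, 0, -1:] ^ Suc k * legendre_deriv n (Suc k)) =
    smult (- ((real n + real k + 1) * (real n - real k))) ([:1, 0, -1:] ^ k * legendre_deriv n k)"
proof (subst poly_eq_poly_eq_iff [symmetric], intro ext)
  fix x :: real
  define w where "w = 1 - x\<^sup>2"
  have V: "poly [:1, 0, -1:] x = w" and V': "poly (pderiv [:1, 0, -1:]) x = - 2 * x"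
    by (simp_all add: w_def pderiv_pCons power2_eq_square)
  have "poly (pderiv ([:1, 0, -1:] ^ Suc k * legendre_deriv n (Suc k))) x =
      w ^ k * (w * poly (legendre_deriv n (k + 2)) x
        - 2 * (real k + 1) * x * poly (legendre_deriv n (k + 1)) x)"
    unfolding pderiv_mult pderiv_power_Suc poly_add poly_mult poly_smult poly_power V V'
    by (simp add: algebra_simps)
  thus "poly (pderiv ([:1, 0, -1:] ^ Suc k * legendre_deriv n (Suc k))) x =
    poly (smult (- ((real n + real k + 1) * (real n - real k)))
      ([:1, 0, -1:] ^ k * legendre_deriv n k)) x"
    unfolding w_def legendre_ode by (simp only: poly_mult poly_smult poly_power V w_def)
      (simp add: algebra_simps)
qed

lemma sum_symmetric_int_interval:
  fixes g :: "nat \<Rightarrow> 'a :: comm_semiring_1"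
  shows "(\<Sum>k = - int n..int n. g (nat \<bar>k\<bar>)) = g 0 + 2 * (\<Sum>k = 1..n. g k)"
proof (induction n)
  case (Suc n)
  have "{- int (Suc n)..int (Suc n)} =
      insert (- int (Suc n)) (insert (int (Suc n)) {- int n..int n})"
    by auto
  hence "(\<Sum>k = - int (Suc n)..int (Suc n). g (nat \<bar>k\<bar>)) =
      g (Suc n) + (g (Suc n) + (\<Sum>k = - int n..int n. g (nat \<bar>k\<bar>)))"
    by (simp add: nat_add_distrib)
  also have "\<dots> = g 0 + 2 * (g (Suc n) + (\<Sum>k = 1..n. g k))"
    unfolding Suc mult_2 by (simp only: ac_simps)
  finally show ?case
    by (simp add: add_ac)
qed simp

text \<open>By the differential equation the derivatives of the individual terms telescope, so the sum
  is constant; its value at \<open>1\<close> is \<open>(legendre n 1)\<^sup>2\<close>.\<close>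

lemma legendre_diagonal_addition:
  "(\<Sum>k = - int n..int n. smult (fact (n - nat \<bar>k\<bar>) / fact (n + nat \<bar>k\<bar>))
     ([:1, 0, -1:] ^ nat \<bar>k\<bar> * (legendre_deriv n (nat \<bar>k\<bar>) * legendre_deriv n (nat \<bar>k\<bar>)))) = 1"
proof -
  define c :: "nat \<Rightarrow> real" where "c = (\<lambda>k. fact (n - k) / fact (n + k))"
  define T where "T = (\<lambda>k. smult (c k) ([:1, 0, -1:] ^ k * (legendre_deriv n k * legendre_deriv n k)))"
  define e where "e = (\<lambda>k. smult (c k) ([:1, 0, -1:] ^ k * (legendre_deriv n k * legendre_deriv n (Suc k))))"
  define S where "S = T 0 + 2 * (\<Sum>k = 1..n. T k)"
  \<comment> \<open>The normalising factorials absorb the eigenvalue of the weighted equation, which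
    makes the telescoping exact. With \<open>d = n - k - 1\<close> no truncated subtraction remains
    in them.\<close>
  have c: "c (Suc k) * ((real n + real k + 1) * (real n - real k)) = c k" if "k < n" for k
  proof -
    obtain d where n: "n = k + Suc d"
      using \<open>k < n\<close> less_iff_Suc_add by auto
    have nk: "n - Suc k = d" "n + Suc k = Suc (2 * k + d + 1)" "n - k = Suc d" "n + k = 2 * k + d + 1"
      using n by simp_all
    define f g :: real where "f = fact d" and "g = fact (2 * k + d + 1)"
    have "c (Suc k) = f / fact (Suc (2 * k + d + 1))"
      unfolding c_def nk f_def ..
    also have "fact (Suc (2 * k + d + 1)) = (real (2 * k + d + 2)) * g"
      unfolding g_def by (subst fact_Suc) simp
    finally have "c (Suc k) = f / (real (2 * k + d + 2) * g)" .
    moreover have "(real n + real k + 1) * (real n - real k) = real (2 * k + d + 2) * real (Suc d)"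
      by (simp add: n)
    ultimately have "c (Suc k) * ((real n + real k + 1) * (real n - real k)) =
        (real (2 * k + d + 2) * (f * real (Suc d))) / (real (2 * k + d + 2) * g)"
      by (simp only: times_divide_eq_left) (simp only: mult_ac)
    also have "\<dots> = f * real (Suc d) / g"
      by (rule mult_divide_mult_cancel_left) (simp only: of_nat_eq_0_iff)
    also have "\<dots> = c k"
      unfolding c_def nk f_def g_def by (simp add: algebra_simps)
    finally show ?thesis .
  qed
  \<comment> \<open>The weight is grouped with one of the two derivatives: differentiating this
    group yields \<open>- e k\<close> by the weighted equation, and differentiating the other factor
    yields \<open>e (Suc k)\<close>.\<close>
  have step: "pderiv (T (Suc k)) = e (Suc k) - e k" if "k < n" for k
  proof -
    define d where "d = (real n + real k + 1) * (real n - real k)"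
    have "pderiv ([:1, 0, -1:] ^ Suc k * legendre_deriv n (Suc k)) =
        smult (- d) ([:1, 0, -1:] ^ k * legendre_deriv n k)"
      unfolding pderiv_weighted_legendre_deriv d_def by simp
    hence "pderiv (([:1, 0, -1:] ^ Suc k * legendre_deriv n (Suc k)) * legendre_deriv n (Suc k)) =
        ([:1, 0, -1:] ^ Suc k * legendre_deriv n (Suc k)) * legendre_deriv n (Suc (Suc k)) -
        smult d ([:1, 0, -1:] ^ k * (legendre_deriv n k * legendre_deriv n (Suc k)))"
      by (subst pderiv_mult) (simp add: algebra_simps)
    thus ?thesis
      unfolding T_def e_def pderiv_smult c[OF that, symmetric] d_def[symmetric]
      by (simp only: mult.assoc smult_diff_right smult_smult)
  qed
  have "pderiv (T 0 + 2 * (\<Sum>k = 1..i. T k)) = 2 * e i" if "i \<le> n" for i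
    using that
  proof (induction i)
    case 0
    show ?case
      by (simp add: T_def e_def pderiv_smult pderiv_mult c_def)
  next
    case (Suc i)
    have double: "pderiv (2 * p) = 2 * pderiv p" for p :: "real poly"
      using pderiv_add[of p p] by (simp flip: mult_2)
    have eq: "T 0 + 2 * (\<Sum>k = 1..Suc i. T k) = 2 * T (Suc i) + (T 0 + 2 * (\<Sum>k = 1..i. T k))"
      by (simp add: distrib_left)
    with Suc step[of i] show ?case
      unfolding eq pderiv_add[of "2 * T (Suc i)"] double by (simp add: right_diff_distrib)
  qed
  \<comment> \<open>At \<open>i = n\<close> the remaining \<open>e n\<close> contains the derivative
    of order \<open>n + 1\<close>, which is zero.\<close>
  hence "pderiv S = 0"
    unfolding S_def e_def by (simp add: legendre_deriv_eq_0 del: funpow.simps)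
  then obtain h where h: "S = [:h:]"
    by (metis pderiv_iszero)
  \<comment> \<open>At \<open>1\<close> the weight annihilates every term but
    \<open>T 0\<close>.\<close>
  have "poly S 1 = 1"
    unfolding S_def T_def
    by (simp add: poly_sum c_def poly_legendre_1 power_0_left sum.neutral)
  with h have "(\<Sum>k = - int n..int n. T (nat \<bar>k\<bar>)) = 1"
    unfolding sum_symmetric_int_interval S_def[symmetric] by (simp add: one_pCons)
  thus ?thesis
    unfolding T_def c_def .
qed

section \<open>Orthogonality and Gauss quadrature\<close>

definition poly_integral :: "real poly \<Rightarrow> real" where
  "poly_integral p = (LBINT x:{-1..1}. poly p x)"

lemma set_integrable_poly: "set_integrable lborel {a..b} (poly p)"
  for p :: "real poly"
  by (intro borel_integrable_atLeastAtMost' continuous_intros)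

lemma poly_integral_pderiv: "poly_integral (pderiv q) = poly q 1 - poly q (-1)"
  unfolding poly_integral_def set_lebesgue_integral_def
  by (intro integral_FTC_atLeastAtMost continuous_intros)
     (auto simp: has_real_derivative_iff_has_vector_derivative[symmetric]
           intro!: has_field_derivative_at_within[OF poly_DERIV])

lemma poly_integral_add: "poly_integral (p + q) = poly_integral p + poly_integral q"
  using set_integral_add(2)[OF set_integrable_poly set_integrable_poly]
  by (simp add: poly_integral_def)

lemma poly_integral_smult: "poly_integral (smult c p) = c * poly_integral p"
  by (simp add: poly_integral_def)

lemma poly_integral_0 [simp]: "poly_integral 0 = 0"
  by (simp add: poly_integral_def)

lemma poly_integral_sum: "poly_integral (\<Sum>i\<in>A. p i) = (\<Sum>i\<in>A. poly_integral (p i))"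
  by (induction A rule: infinite_finite_induct) (simp_all add: poly_integral_add)

lemma poly_integral_1: "poly_integral 1 = 2"
  using poly_integral_pderiv[of "[:0, 1:]"] by (simp add: pderiv_pCons one_pCons)

lemma poly_integral_square_nonneg: "poly_integral (p * p) \<ge> 0"
  unfolding poly_integral_def set_lebesgue_integral_def by (rule Bochner_Integration.integral_nonneg) simp

lemma poly_antiderivative_exists:
  fixes p :: "real poly"
  shows "\<exists>q. pderiv q = p"
proof
  have "pderiv (\<Sum>i\<le>degree p. monom (coeff p i / real (Suc i)) (Suc i)) =
      (\<Sum>i\<le>degree p. monom (coeff p i) i)"
    by (simp add: higher_pderiv_sum[where n = 1, simplified] pderiv_monom del: of_nat_Suc)
  thus "pderiv (\<Sum>i\<le>degree p. monom (coeff p i / real (Suc i)) (Suc i)) = p"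
    by (simp add: poly_as_sum_of_monoms)
qed

text \<open>Integration by parts in the self-adjoint form; the boundary terms vanish because
  \<open>1 - x^2\<close> does at both endpoints.\<close>

lemma poly_integral_weighted_legendre_deriv_Suc:
  "poly_integral ([:1, 0, -1:] ^ Suc k * legendre_deriv n (Suc k) * legendre_deriv n' (Suc k)) =
    (real n + real k + 1) * (real n - real k) *
      poly_integral ([:1, 0, -1:] ^ k * legendre_deriv n k * legendre_deriv n' k)"
proof -
  let ?p = "[:1, 0, -1:] ^ Suc k * legendre_deriv n (Suc k)"
  define c where "c = (real n + real k + 1) * (real n - real k)"
  have "pderiv (?p * legendre_deriv n' k) =
      ?p * legendre_deriv n' (Suc k) +
      smult (- c) ([:1, 0, -1:] ^ k * legendre_deriv n k * legendre_deriv n' k)"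
    unfolding pderiv_mult[of ?p] pderiv_weighted_legendre_deriv c_def by (simp add: mult_ac)
  moreover have "poly_integral (pderiv (?p * legendre_deriv n' k)) = 0"
    unfolding poly_integral_pderiv by simp
  ultimately show ?thesis
    unfolding c_def[symmetric] by (simp only: poly_integral_add poly_integral_smult)
qed

text \<open>The weighted integral \<open>X\<close> of the two first derivatives is symmetric in the
  degrees, yet by parts it equals \<open>n * (n + 1)\<close> times the integral in question.
  Different degrees have different eigenvalues.\<close>

lemma legendre_orthogonal:
  assumes "n \<noteq> n'"
  shows "poly_integral (legendre n * legendre n') = 0"
proof -
  define X where "X = (\<lambda>n n'. poly_integral
    ([:1, 0, -1:] ^ Suc 0 * legendre_deriv n (Suc 0) * legendre_deriv n' (Suc 0)))"
  have X: "X n n' = real n * (real n + 1) * poly_integral (legendre n * legendre n')" for n n'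
    unfolding X_def by (subst poly_integral_weighted_legendre_deriv_Suc) simp
  have "X n n' = X n' n"
    unfolding X_def by (simp only: mult_ac)
  hence "real n * (real n + 1) * poly_integral (legendre n * legendre n') =
      real n' * (real n' + 1) * poly_integral (legendre n * legendre n')"
    unfolding X by (simp only: mult_ac)
  moreover have "real n * (real n + 1) \<noteq> real n' * (real n' + 1)"
  proof
    assume "real n * (real n + 1) = real n' * (real n' + 1)"
    hence "(real n - real n') * (real n + real n' + 1) = 0"
      by (simp add: algebra_simps)
    thus False
      using assms by (simp add: add_nonneg_eq_0_iff)
  qed
  ultimately show ?thesis
    by auto
qed

text \<open>Each integration by parts contributes \<open>(n + k + 1) * (n - k)\<close>, which the
  change in the quotient of factorials removes. The quotient involves \<open>n\<close> only, while
  \<open>n'\<close> is arbitrary.\<close>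

lemma poly_integral_weighted_legendre_deriv:
  assumes "k \<le> n"
  shows "fact (n - k) / fact (n + k) *
      poly_integral ([:1, 0, -1:] ^ k * legendre_deriv n k * legendre_deriv n' k) =
    poly_integral (legendre n * legendre n')"
  using assms
proof (induction k)
  case (Suc k)
  define A B where "A = real n + real k + 1" and "B = real n - real k"
  have "n - k = Suc (n - Suc k)"
    using Suc.prems by simp
  hence fact_B: "fact (n - k) = B * fact (n - Suc k)"
    using Suc.prems by (simp add: B_def of_nat_diff)
  have fact_A: "fact (n + Suc k) = A * fact (n + k)"
    by (simp add: A_def)
  have "A \<noteq> 0"
    unfolding A_def by linarith
  hence "fact (n - Suc k) / (A * fact (n + k)) * (A * B * x) =
      B * fact (n - Suc k) / fact (n + k) * x" for x
    by simp
  with Suc show ?case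
    unfolding poly_integral_weighted_legendre_deriv_Suc A_def[symmetric] B_def[symmetric] fact_A fact_B
    by simp
qed simp

text \<open>Integrating \<open>legendre_diagonal_addition\<close>: by \<open>poly_integral_weighted_legendre_deriv\<close> all
  \<open>2 n + 1\<close> terms contribute equally.\<close>

lemma poly_integral_legendre_square: "poly_integral (legendre n * legendre n) = 2 / (2 * real n + 1)"
proof -
  have "2 = poly_integral (\<Sum>k = - int n..int n. smult (fact (n - nat \<bar>k\<bar>) / fact (n + nat \<bar>k\<bar>))
     ([:1, 0, -1:] ^ nat \<bar>k\<bar> * (legendre_deriv n (nat \<bar>k\<bar>) * legendre_deriv n (nat \<bar>k\<bar>))))"
    unfolding legendre_diagonal_addition poly_integral_1 ..
  also have "\<dots> = (\<Sum>k = - int n..int n. poly_integral (legendre n * legendre n))"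
    unfolding poly_integral_sum poly_integral_smult
  proof (rule sum.cong [OF refl], goal_cases)
    case (1 k)
    hence "nat \<bar>k\<bar> \<le> n"
      by auto
    from poly_integral_weighted_legendre_deriv[OF this, of n] show ?case
      by (simp add: mult.assoc)
  qed
  finally show ?thesis
    by (simp add: field_simps)
qed

section \<open>Products of associated Legendre functions of equal order\<close>

definition assoc_legendre_prod :: "nat \<Rightarrow> nat \<Rightarrow> nat \<Rightarrow> real poly" where
  "assoc_legendre_prod n n' k =
    smult (sqrt (fact (n - k) / fact (n + k)) * sqrt (fact (n' - k) / fact (n' + k)))
      ([:1, 0, -1:] ^ k * legendre_deriv n k * legendre_deriv n' k)"

text \<open>With equal orders the two powers of \<open>sqrt (1 - x^2)\<close> combine to a power of
  \<open>1 - x^2\<close>, so on the interval the product is a polynomial and quadrature applies to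
  it.\<close>

lemma poly_assoc_legendre_prod:
  assumes "-1 \<le> x" "x \<le> 1"
  shows "poly (assoc_legendre_prod n n' k) x = assoc_legendre n k x * assoc_legendre n' k x"
proof -
  have "0 \<le> 1 - x\<^sup>2"
    using assms by (simp add: abs_square_le_1 abs_le_iff)
  hence "sqrt (1 - x\<^sup>2) ^ k * sqrt (1 - x\<^sup>2) ^ k = (1 - x\<^sup>2) ^ k"
    by (simp flip: power_mult_distrib)
  moreover have "poly [:1, 0, -1:] x = 1 - x\<^sup>2"
    by (simp add: power2_eq_square)
  ultimately show ?thesis
    by (simp add: assoc_legendre_prod_def assoc_legendre_def mult_ac del: poly_pCons)
qed

text \<open>The weight adds \<open>2 * k\<close> to the degree and the two derivatives remove
  \<open>k\<close> each.\<close>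

lemma degree_assoc_legendre_prod_le:
  assumes "k \<le> n" "k \<le> n'"
  shows "degree (assoc_legendre_prod n n' k) \<le> n + n'"
proof -
  have "degree ([:1, 0, -1 :: real:] ^ k) = 2 * k"
    by (simp add: degree_power_eq)
  hence "degree ([:1, 0, -1:] ^ k * legendre_deriv n k * legendre_deriv n' k) \<le> n + n'"
    using degree_mult_le[of "[:1, 0, -1:] ^ k * legendre_deriv n k" "legendre_deriv n' k"]
      degree_mult_le[of "[:1, 0, -1:] ^ k" "legendre_deriv n k"] assms
    by (simp add: degree_higher_pderiv degree_legendre)
  thus ?thesis
    unfolding assoc_legendre_prod_def using degree_smult_le order_trans by blast
qed

lemma poly_integral_assoc_legendre_prod:
  assumes "k \<le> n" "k \<le> n'"
  shows "poly_integral (assoc_legendre_prod n n' k) = (if n = n' then 2 / (2 * real n + 1) else 0)"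
proof (cases "n = n'")
  case True
  have "sqrt (fact (n - k) / fact (n + k)) * sqrt (fact (n - k) / fact (n + k)) =
      (fact (n - k) / fact (n + k) :: real)"
    by simp
  thus ?thesis
    using poly_integral_weighted_legendre_deriv[OF assms(1), of n] True
    unfolding assoc_legendre_prod_def poly_integral_smult
    by (simp only: poly_integral_legendre_square) simp
next
  case False
  have "fact (n - k) / fact (n + k) *
      poly_integral ([:1, 0, -1:] ^ k * legendre_deriv n k * legendre_deriv n' k) = 0"
    using poly_integral_weighted_legendre_deriv[OF assms(1), of n'] legendre_orthogonal[OF False]
    by simp
  thus ?thesis
    unfolding assoc_legendre_prod_def poly_integral_smult using False by simp
qed

lemma sum_assoc_legendre_squares:
  assumes "-1 \<le> x" "x \<le> 1"
  shows "(\<Sum>k = - int n..int n. (assoc_legendre n (nat \<bar>k\<bar>) x)\<^sup>2) = 1"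
proof -
  have "(assoc_legendre n k x)\<^sup>2 = poly (smult (fact (n - k) / fact (n + k))
     ([:1, 0, -1:] ^ k * (legendre_deriv n k * legendre_deriv n k))) x" for k
    using poly_assoc_legendre_prod[OF assms, of n n k]
    by (simp add: assoc_legendre_prod_def power2_eq_square mult.assoc del: poly_pCons)
  hence "(\<Sum>k = - int n..int n. (assoc_legendre n (nat \<bar>k\<bar>) x)\<^sup>2) =
    poly (\<Sum>k = - int n..int n. smult (fact (n - nat \<bar>k\<bar>) / fact (n + nat \<bar>k\<bar>))
     ([:1, 0, -1:] ^ nat \<bar>k\<bar> * (legendre_deriv n (nat \<bar>k\<bar>) * legendre_deriv n (nat \<bar>k\<bar>)))) x"
    unfolding poly_sum by simp
  thus ?thesis
    unfolding legendre_diagonal_addition by simp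
qed

text \<open>Strong induction on the degree: subtracting a multiple of the Legendre polynomial of the
  same degree removes the leading term, and that multiple is orthogonal to
  \<open>legendre n\<close>.\<close>

lemma legendre_orthogonal_lower_degree:
  assumes "degree p < n \<or> p = 0"
  shows "poly_integral (p * legendre n) = 0"
  using assms
proof (induction "degree p" arbitrary: p rule: less_induct)
  case less
  show ?case
  proof (cases "p = 0")
    case False
    let ?d = "degree p"
    define c where "c = lead_coeff p / lead_coeff (legendre ?d)"
    define q where "q = p - smult c (legendre ?d)"
    have p: "p = q + smult c (legendre ?d)"
      by (simp add: q_def)
    have "degree q \<le> ?d"
      unfolding q_def by (intro degree_diff_le order_trans[OF degree_smult_le]) (simp_all add: degree_legendre)
    moreover have "coeff q ?d = 0"
      using leading_coeff_0_iff[of "legendre ?d"]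
      by (simp add: q_def c_def degree_legendre)
    \<comment> \<open>A constant \<open>p\<close> leaves \<open>q = 0\<close>, whose degree is not
      smaller; hence the second alternative.\<close>
    ultimately have "degree q < ?d \<or> q = 0"
      by (metis le_neq_implies_less leading_coeff_0_iff)
    hence "poly_integral (q * legendre n) = 0"
      using less by (cases "q = 0") auto
    moreover have "poly_integral (legendre ?d * legendre n) = 0"
      using less.prems False by (intro legendre_orthogonal) simp
    ultimately show ?thesis
      by (subst p) (simp add: distrib_right poly_integral_add poly_integral_smult)
  qed simp
qed

section \<open>Location of the Legendre roots\<close>

lemma poly_pderiv_roots:
  fixes p :: "real poly"
  assumes "card A = Suc k" "\<forall>x\<in>A. poly p x = 0" "A \<subseteq> {a..b}"
  shows "\<exists>B. finite B \<and> card B = k \<and> B \<subseteq> {a<..<b} \<and> (\<forall>x\<in>B. poly (pderiv p) x = 0)"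
  using assms
proof (induction k arbitrary: A b)
  case (Suc k)
  have A: "finite A" "A \<noteq> {}"
    using Suc.prems(1) card.infinite by fastforce+
  \<comment> \<open>Rolle's theorem is counted by induction: the largest root is set aside, the
    hypothesis is applied up to \<open>Max A'\<close>, and the zero between the two largest roots is
    new because the others lie strictly below \<open>Max A'\<close>.\<close>
  define A' where "A' = A - {Max A}"
  have card: "card A' = Suc k"
    using Suc.prems(1) A by (simp add: A'_def)
  hence A': "finite A'" "A' \<noteq> {}"
    using card.infinite by fastforce+
  have in_A: "Max A' \<in> A" "Max A \<in> A" "Max A' \<noteq> Max A" "A' \<subseteq> A"
    using A Max_in[OF A'] by (auto simp: A'_def)
  hence less: "Max A' < Max A"
    using A by (simp add: order.not_eq_order_implies_strict)
  have "A' \<subseteq> {a..Max A'}"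
    using A' in_A(4) Suc.prems(3) by auto
  then obtain B where B: "finite B" "card B = k" "B \<subseteq> {a<..<Max A'}" "\<forall>x\<in>B. poly (pderiv p) x = 0"
    using Suc.IH[OF card, of "Max A'"] Suc.prems in_A by blast
  obtain z where z: "Max A' < z" "z < Max A" "poly (pderiv p) z = 0"
    using poly_MVT[OF less, of p] in_A Suc.prems(2) less by auto
  have ab: "a \<le> Max A'" "Max A \<le> b"
    using in_A Suc.prems(3) by auto
  have "card (insert z B) = Suc k"
    using B z by (subst card_insert_disjoint) auto
  moreover have "insert z B \<subseteq> {a<..<b}"
    using B(3) z ab by fastforce
  ultimately show ?case
    using B z(3) by (intro exI[of _ "insert z B"]) auto
qed (intro exI[of _ "{}"], auto)

text \<open>For \<open>k < n\<close> the derivative of order \<open>k\<close> still vanishes at both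
  endpoints. Together with its \<open>k\<close> interior zeros this gives \<open>k + 2\<close>
  zeros, hence \<open>k + 1\<close> interior zeros of the next derivative.\<close>

lemma rodrigues_roots:
  assumes "k \<le> n"
  shows "\<exists>A. finite A \<and> card A = k \<and> A \<subseteq> {-1<..<1} \<and>
    (\<forall>x\<in>A. poly ((pderiv ^^ k) ([:-1, 0, 1:] ^ n)) x = (0 :: real))"
  using assms
proof (induction k)
  case (Suc k)
  let ?u = "[:-1, 0, 1:] ^ n :: real poly"
  obtain A where A: "finite A" "card A = k" "A \<subseteq> {-1<..<1}"
    "\<forall>x\<in>A. poly ((pderiv ^^ k) ?u) x = 0"
    using Suc by auto
  have factor: "?u = [:- a, 1:] ^ n * [:a, 1:] ^ n" if "a = 1 \<or> a = -1" for a :: real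
    using that by (auto simp flip: power_mult_distrib)
  have ends: "poly ((pderiv ^^ k) ?u) a = 0" if a: "a = 1 \<or> a = -1" for a :: real
  proof -
    obtain r where "(pderiv ^^ k) ([:- a, 1:] ^ (n - k + k) * [:a, 1:] ^ n) = [:- a, 1:] ^ (n - k) * r"
      using poly_higher_pderiv_power_mult by metis
    thus ?thesis
      using Suc.prems factor[OF a] by simp
  qed
  have "card (insert (-1) (insert 1 A)) = Suc (Suc k)"
    using A by (subst card_insert_disjoint, force, force)+ simp
  from poly_pderiv_roots[OF this, of "(pderiv ^^ k) ?u" "-1" 1] show ?case
    using A ends by (force simp: subset_iff)
qed (intro exI[of _ "{}"], auto)

text \<open>The case \<open>k = n\<close> of \<open>rodrigues_roots\<close> supplies
  \<open>n\<close> zeros in the open interval, and the degree admits no more.\<close>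

lemma legendre_roots:
  "finite {x. poly (legendre n) x = 0}" "card {x. poly (legendre n) x = 0} = n"
  "{x. poly (legendre n) x = 0} \<subseteq> {-1<..<1}"
proof -
  let ?Z = "{x. poly (legendre n) x = 0}"
  obtain A where A: "finite A" "card A = n" "A \<subseteq> {-1<..<1}" "A \<subseteq> ?Z"
    using rodrigues_roots[of n n] by (auto simp: legendre_def subset_iff)
  show fin: "finite ?Z"
    by (rule poly_roots_finite) simp
  have "card ?Z \<le> n"
    using card_poly_roots_bound[of "legendre n"] by (simp add: degree_legendre)
  hence "A = ?Z"
    using A fin by (intro card_seteq) auto
  with A show "card ?Z = n" "?Z \<subseteq> {-1<..<1}"
    by auto
qed

lemma bij_betw_legendre_root: "bij_betw (legendre_root n) {1..n} {x. poly (legendre n) x = 0}"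
proof -
  let ?xs = "sorted_list_of_set {x. poly (legendre n) x = 0}"
  have "bij_betw (\<lambda>l. l - 1) {1..n} {..<n}"
    by (rule bij_betw_byWitness[of _ Suc]) auto
  moreover have "bij_betw ((!) ?xs) {..<n} (set ?xs)"
    by (rule bij_betw_nth) (simp_all add: legendre_roots)
  ultimately have "bij_betw ((!) ?xs \<circ> (\<lambda>l. l - 1)) {1..n} (set ?xs)"
    by (rule bij_betw_trans)
  thus ?thesis
    using legendre_roots(1) by (simp add: legendre_root_def[abs_def] o_def)
qed

lemma legendre_root:
  assumes "l \<in> {1..n}"
  shows "poly (legendre n) (legendre_root n l) = 0" "-1 < legendre_root n l" "legendre_root n l < 1"
proof -
  have "legendre_root n l \<in> {x. poly (legendre n) x = 0}"
    using bij_betw_apply[OF bij_betw_legendre_root assms] .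
  moreover from this have "legendre_root n l \<in> {-1<..<1}"
    using legendre_roots(3) by blast
  ultimately show "poly (legendre n) (legendre_root n l) = 0" "-1 < legendre_root n l" "legendre_root n l < 1"
    by auto
qed

section \<open>Lagrange interpolation and Gauss quadrature\<close>

lemma poly_lagrange_basis:
  assumes "k \<in> {1..n}" "l \<in> {1..n}"
  shows "poly (lagrange_basis n k) (legendre_root n l) = (if l = k then 1 else 0)"
proof -
  have inj: "legendre_root n k \<noteq> legendre_root n i" if "i \<in> {1..n} - {k}" for i
    using inj_onD[OF bij_betw_imp_inj_on[OF bij_betw_legendre_root], of n k i] that assms by blast
  show ?thesis
  proof (cases "l = k")
    case True
    thus ?thesis
      unfolding lagrange_basis_def poly_prod using inj
      by (auto intro!: prod.neutral simp: divide_simps)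
  next
    case False
    have "(\<Prod>i\<in>{1..n} - {k}. poly (smult (1 / (legendre_root n k - legendre_root n i))
        [:- legendre_root n i, 1:]) (legendre_root n l)) = 0"
      by (rule prod_zero) (use False assms in auto)
    thus ?thesis
      unfolding lagrange_basis_def poly_prod using False by simp
  qed
qed

lemma degree_lagrange_basis:
  assumes "k \<in> {1..n}"
  shows "degree (lagrange_basis n k) \<le> n - 1"
proof -
  have "degree (lagrange_basis n k) \<le>
      sum (degree \<circ> (\<lambda>i. smult (1 / (legendre_root n k - legendre_root n i)) [:- legendre_root n i, 1:]))
        ({1..n} - {k})"
    unfolding lagrange_basis_def by (rule degree_prod_sum_le) simp
  also have "\<dots> \<le> (\<Sum>i\<in>{1..n} - {k}. 1)"
    by (rule sum_mono) simp
  also have "\<dots> = n - 1"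
    using assms by simp
  finally show ?thesis .
qed

text \<open>Both sides have degree below \<open>n\<close> and agree at the \<open>n\<close>
  roots.\<close>

lemma lagrange_interpolation:
  assumes "degree p < n"
  shows "p = (\<Sum>l = 1..n. smult (poly p (legendre_root n l)) (lagrange_basis n l))"
proof (rule poly_eqI_degree[where A = "{x. poly (legendre n) x = 0}"])
  fix x assume "x \<in> {x. poly (legendre n) x = 0}"
  then obtain k where k: "k \<in> {1..n}" "x = legendre_root n k"
    unfolding bij_betw_imp_surj_on[OF bij_betw_legendre_root, symmetric] by blast
  show "poly p x = poly (\<Sum>l = 1..n. smult (poly p (legendre_root n l)) (lagrange_basis n l)) x"
    using k by (simp add: poly_sum poly_lagrange_basis if_distrib[of "\<lambda>t. _ * t"] sum.delta cong: if_cong)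
next
  have "degree (\<Sum>l = 1..n. smult (poly p (legendre_root n l)) (lagrange_basis n l)) \<le> n - 1"
    by (intro degree_sum_le order_trans[OF degree_smult_le] degree_lagrange_basis) auto
  thus "degree (\<Sum>l = 1..n. smult (poly p (legendre_root n l)) (lagrange_basis n l)) <
      card {x. poly (legendre n) x = 0}"
    using assms by (simp add: legendre_roots)
qed (use assms in \<open>simp add: legendre_roots\<close>)

lemma gauss_weight_eq: "gauss_weight n l = poly_integral (lagrange_basis n l)"
  by (simp add: gauss_weight_def poly_integral_def)

text \<open>After division by \<open>legendre n\<close> the quotient has degree below
  \<open>n\<close>; its product with \<open>legendre n\<close> vanishes at the nodes and has
  integral zero by orthogonality. The remainder is covered by interpolation.\<close>

lemma gauss_quadrature:
  assumes "degree p < 2 * n"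
  shows "(\<Sum>l = 1..n. gauss_weight n l * poly p (legendre_root n l)) = poly_integral p"
proof -
  define q r where "q = p div legendre n" and "r = p mod legendre n"
  have p: "p = q * legendre n + r"
    by (simp add: q_def r_def)
  have "degree r < n"
    using degree_mod_less[of "legendre n" p] assms by (auto simp: degree_legendre r_def)
  have "degree q < n \<or> q = 0"
  proof (rule ccontr)
    assume "\<not> (degree q < n \<or> q = 0)"
    hence "degree (q * legendre n) \<ge> 2 * n"
      by (simp add: degree_mult_eq degree_legendre)
    moreover have "degree p = degree (q * legendre n)"
      unfolding p using calculation \<open>degree r < n\<close> by (intro degree_add_eq_left) simp
    ultimately show False
      using assms by simp
  qed
  hence "poly_integral p = poly_integral r"
    by (subst p) (simp add: poly_integral_add legendre_orthogonal_lower_degree)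
  also have "\<dots> = (\<Sum>l = 1..n. gauss_weight n l * poly r (legendre_root n l))"
    by (subst lagrange_interpolation[OF \<open>degree r < n\<close>])
       (simp add: poly_integral_sum poly_integral_smult gauss_weight_eq mult.commute)
  also have "\<dots> = (\<Sum>l = 1..n. gauss_weight n l * poly p (legendre_root n l))"
    by (rule sum.cong[OF refl], subst p) (simp add: legendre_root)
  finally show ?thesis ..
qed

text \<open>Quadrature is applied to the square of \<open>lagrange_basis n l\<close>, of degree at
  most \<open>2 * n - 2\<close>. The sum collapses to the weight, which is thus the integral of a
  square.\<close>

lemma gauss_weight_nonneg:
  assumes "l \<in> {1..n}"
  shows "gauss_weight n l \<ge> 0"
proof -
  let ?L = "lagrange_basis n l"
  have "degree (?L * ?L) < 2 * n"
    using degree_mult_le[of ?L ?L] degree_lagrange_basis[OF assms] assms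
    unfolding atLeastAtMost_iff by linarith
  from gauss_quadrature[OF this] have
    "(\<Sum>k = 1..n. gauss_weight n k * (poly ?L (legendre_root n k) * poly ?L (legendre_root n k))) \<ge> 0"
    by (simp add: poly_integral_square_nonneg)
  also have "(\<Sum>k = 1..n. gauss_weight n k * (poly ?L (legendre_root n k) * poly ?L (legendre_root n k)))
      = (\<Sum>k = 1..n. if k = l then gauss_weight n l else 0)"
    by (rule sum.cong) (use assms in \<open>auto simp: poly_lagrange_basis\<close>)
  finally show ?thesis
    using assms by simp
qed

section \<open>Orthonormality on the sphere and on the nodes\<close>

lemma set_integral_exp_int:
  "(LBINT \<phi>:{0..2*pi}. exp (\<i> * of_int k * of_real \<phi>)) = (if k = 0 then 2 * of_real pi else 0)"
proof (cases "k = 0")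
  case True
  thus ?thesis
    by (simp add: set_integral_const scaleR_conv_of_real)
next
  case False
  let ?F = "\<lambda>\<phi>. exp (\<i> * of_int k * of_real \<phi>) / (\<i> * of_int k)"
  have "(?F has_vector_derivative exp (\<i> * of_int k * of_real \<phi>)) (at \<phi> within A)" for \<phi> A
    using False by (auto intro!: derivative_eq_intros has_vector_derivative_real_field)
  hence "(LBINT \<phi>:{0..2*pi}. exp (\<i> * of_int k * of_real \<phi>)) = ?F (2 * pi) - ?F 0"
    unfolding set_lebesgue_integral_def
    by (intro integral_FTC_atLeastAtMost continuous_intros) simp_all
  moreover have "exp (\<i> * of_int k * of_real (2 * pi)) = 1"
    using exp_integer_2pi[of "of_int k"] by (simp add: mult_ac)
  ultimately show ?thesis
    using False by simp
qed

lemma set_integral_sum_continuous: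
  fixes f :: "'i \<Rightarrow> real \<Rightarrow> complex"
  assumes "finite I" "\<And>i. i \<in> I \<Longrightarrow> continuous_on {a..b} (f i)"
  shows "(LBINT x:{a..b}. \<Sum>i\<in>I. f i x) = (\<Sum>i\<in>I. LBINT x:{a..b}. f i x)"
  using assms
proof (induction I rule: finite_induct)
  case (insert j I)
  have "(LBINT x:{a..b}. f j x + (\<Sum>i\<in>I. f i x)) =
      (LBINT x:{a..b}. f j x) + (LBINT x:{a..b}. \<Sum>i\<in>I. f i x)"
    using insert by (intro set_integral_add borel_integrable_atLeastAtMost' continuous_on_sum) auto
  with insert show ?case
    by simp
qed (simp add: set_lebesgue_integral_def)

text \<open>The azimuthal integral removes every mode but zero, and \<open>2 * pi / (4 * pi)\<close>
  leaves the factor \<open>1 / 2\<close>. Continuity of the separated terms justifies exchanging the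
  finite sum with both integrals.\<close>

lemma sph_integral_separable:
  fixes F :: "'i \<Rightarrow> S2 \<Rightarrow> complex" and k :: "'i \<Rightarrow> int"
  assumes "finite I"
    and F: "\<And>i \<theta> \<phi>. i \<in> I \<Longrightarrow> 0 \<le> \<theta> \<Longrightarrow> \<theta> \<le> pi \<Longrightarrow>
      F i (sph_point \<theta> \<phi>) = of_real (u i \<theta>) * exp (\<i> * of_int (k i) * of_real \<phi>)"
    and u: "\<And>i. i \<in> I \<Longrightarrow> continuous_on {0..pi} (u i)"
  shows "sph_integral (\<lambda>\<xi>. \<Sum>i\<in>I. c i * F i \<xi>) =
    (\<Sum>i\<in>I. c i * (if k i = 0 then of_real ((LBINT \<theta>:{0..pi}. u i \<theta> * sin \<theta>) / 2) else 0))"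
proof -
  define U where "U = (\<lambda>i. LBINT \<theta>:{0..pi}. u i \<theta> * sin \<theta>)"
  have "(LBINT \<theta>:{0..pi}. (\<Sum>i\<in>I. c i * F i (sph_point \<theta> \<phi>)) * of_real (sin \<theta>)) =
      (\<Sum>i\<in>I. c i * of_real (U i) * exp (\<i> * of_int (k i) * of_real \<phi>))" for \<phi>
  proof -
    let ?E = "\<lambda>i. exp (\<i> * of_int (k i) * of_real \<phi>)"
    have "(LBINT \<theta>:{0..pi}. (\<Sum>i\<in>I. c i * F i (sph_point \<theta> \<phi>)) * of_real (sin \<theta>)) =
        (LBINT \<theta>:{0..pi}. \<Sum>i\<in>I. c i * ?E i * of_real (u i \<theta> * sin \<theta>))"
      by (rule set_lebesgue_integral_cong) (auto simp: F sum_distrib_left sum_distrib_right mult_ac)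
    also have "\<dots> = (\<Sum>i\<in>I. LBINT \<theta>:{0..pi}. c i * ?E i * of_real (u i \<theta> * sin \<theta>))"
      by (rule set_integral_sum_continuous[OF \<open>finite I\<close>]) (intro continuous_intros u)
    also have "\<dots> = (\<Sum>i\<in>I. c i * of_real (U i) * ?E i)"
      unfolding set_integral_mult_right U_def set_integral_complex_of_real by (simp only: mult_ac)
    finally show ?thesis .
  qed
  hence "sph_integral (\<lambda>\<xi>. \<Sum>i\<in>I. c i * F i \<xi>) = 1 / (4 * of_real pi) *
      (LBINT \<phi>:{0..2*pi}. \<Sum>i\<in>I. c i * of_real (U i) * exp (\<i> * of_int (k i) * of_real \<phi>))"
    by (simp add: sph_integral_def)
  also have "(LBINT \<phi>:{0..2*pi}. \<Sum>i\<in>I. c i * of_real (U i) * exp (\<i> * of_int (k i) * of_real \<phi>)) =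
      (\<Sum>i\<in>I. LBINT \<phi>:{0..2*pi}. c i * of_real (U i) * exp (\<i> * of_int (k i) * of_real \<phi>))"
    by (rule set_integral_sum_continuous[OF \<open>finite I\<close>]) (intro continuous_intros)
  also have "\<dots> = (\<Sum>i\<in>I. c i * of_real (U i) * (if k i = 0 then 2 * of_real pi else 0))"
    unfolding set_integral_mult_right set_integral_exp_int ..
  also have "1 / (4 * of_real pi) * \<dots> =
      (\<Sum>i\<in>I. c i * (if k i = 0 then of_real (U i / 2) else 0))"
    unfolding sum_distrib_left by (rule sum.cong) (auto simp: field_simps)
  finally show ?thesis
    unfolding U_def .
qed

text \<open>With an antiderivative \<open>q\<close> of \<open>p\<close>, the function
  \<open>- q (cos \<theta>)\<close> is an antiderivative of the integrand, and both sides equal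
  \<open>q 1 - q (-1)\<close>.\<close>

lemma set_integral_poly_cos: "(LBINT \<theta>:{0..pi}. poly p (cos \<theta>) * sin \<theta>) = poly_integral p"
proof -
  obtain q where q: "pderiv q = p"
    using poly_antiderivative_exists by blast
  let ?F = "\<lambda>\<theta>. - poly q (cos \<theta>)"
  have "(?F has_real_derivative poly p (cos \<theta>) * sin \<theta>) (at \<theta> within A)" for \<theta> A
    by (rule derivative_eq_intros poly_DERIV DERIV_chain2 refl | simp add: q)+
  hence "(LBINT \<theta>:{0..pi}. poly p (cos \<theta>) * sin \<theta>) = ?F pi - ?F 0"
    unfolding set_lebesgue_integral_def has_real_derivative_iff_has_vector_derivative
    by (intro integral_FTC_atLeastAtMost continuous_intros) auto
  thus ?thesis
    using poly_integral_pderiv[of q] by (simp add: q)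
qed

lemma continuous_on_assoc_legendre: "continuous_on A (assoc_legendre n k)"
  unfolding assoc_legendre_def[abs_def] by (intro continuous_intros)

lemma sph_Y_mult_cnj:
  assumes "0 \<le> \<theta>" "\<theta> \<le> pi"
  shows "sph_Y n k (sph_point \<theta> \<phi>) * cnj (sph_Y n' k' (sph_point \<theta> \<phi>)) =
    of_real (sqrt (2 * real n + 1) * sqrt (2 * real n' + 1) *
      (assoc_legendre n (nat \<bar>k\<bar>) (cos \<theta>) * assoc_legendre n' (nat \<bar>k'\<bar>) (cos \<theta>))) *
    exp (\<i> * of_int (k - k') * of_real \<phi>)"
proof -
  have "exp (\<i> * of_int (k - k') * of_real \<phi>) =
      exp (\<i> * of_int k * of_real \<phi>) * exp (- (\<i> * of_int k' * of_real \<phi>))"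
    by (simp add: algebra_simps flip: exp_add)
  moreover have "cnj (exp (\<i> * of_int k' * of_real \<phi>)) = exp (- (\<i> * of_int k' * of_real \<phi>))"
    by (simp add: exp_cnj)
  ultimately show ?thesis
    using assms by (simp add: sph_Y_sph_point mult_ac)
qed

text \<open>The terms are powers of a number \<open>z\<close> with
  \<open>z ^ (2 * N + 1) = 1\<close>, so the geometric sum vanishes unless \<open>z = 1\<close>. The
  bound on \<open>d\<close> excludes the nonzero multiples of \<open>2 * N + 1\<close>.\<close>

lemma sum_exp_nodes:
  assumes "\<bar>d\<bar> \<le> 2 * int N"
  shows "(\<Sum>i = 0..2*N. exp (\<i> * of_int d * of_real (2 * pi * real i / (2 * real N + 1)))) =
    (if d = 0 then 2 * of_nat N + 1 else 0)"
proof (cases "d = 0")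
  case False
  define z where "z = exp (2 * of_real pi * \<i> * (of_int d / (2 * of_nat N + 1)))"
  have nz: "2 * of_nat N + 1 \<noteq> (0 :: complex)"
    using of_nat_eq_0_iff[of "2 * N + 1", where 'a = complex] by (simp add: add.commute)
  have pow: "exp (\<i> * of_int d * of_real (2 * pi * real i / (2 * real N + 1))) = z ^ i" for i
    unfolding z_def by (simp flip: exp_of_nat_mult add: field_simps)
  have "z \<noteq> 1"
  proof
    assume "z = 1"
    then obtain j :: int where "2 * pi * (real_of_int d / (2 * real N + 1)) = of_int (2 * j) * pi"
      unfolding z_def exp_eq_1 by auto
    hence "2 * pi * (real_of_int d / (2 * real N + 1)) = 2 * pi * of_int j"
      by (simp only: of_int_mult of_int_numeral mult_ac)
    hence "real_of_int d / (2 * real N + 1) = of_int j"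
      by (simp only: mult_cancel_left) simp
    moreover have "2 * real N + 1 \<noteq> 0"
      by linarith
    ultimately have "real_of_int d = of_int (j * (2 * int N + 1))"
      by (simp add: divide_eq_eq)
    hence "d = j * (2 * int N + 1)"
      by (simp only: of_int_eq_iff)
    with False have "\<bar>d\<bar> \<ge> 2 * int N + 1"
      by (auto simp: abs_mult)
    with assms show False
      by simp
  qed
  moreover have "z ^ (2 * N + 1) = 1"
  proof -
    have "z ^ (2 * N + 1) = exp (2 * of_real pi * \<i> * of_int d)"
    proof -
      define c :: complex where "c = 2 * of_nat N + 1"
      have "of_nat (2 * N + 1) = c"
        by (simp add: c_def)
      moreover have "c * (2 * of_real pi * \<i> * (of_int d / c)) = 2 * of_real pi * \<i> * of_int d"
        using nz by (simp add: c_def[symmetric])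
      ultimately show ?thesis
        unfolding z_def c_def[symmetric] exp_of_nat_mult[symmetric] by (simp only:)
    qed
    thus ?thesis
      using exp_integer_2pi[of "of_int d"] by (simp add: mult_ac)
  qed
  ultimately have "(\<Sum>i<2*N+1. z ^ i) = 0"
    by (simp only: geometric_sum not_False_eq_True diff_self div_0)
  moreover have "{0..2*N} = {..<2*N+1}"
    by auto
  ultimately show ?thesis
    using False unfolding pow by simp
qed simp

section \<open>Orthonormality in coordinates\<close>

abbreviation harmonic_index :: "nat \<Rightarrow> (nat \<times> int) set" where
  "harmonic_index M \<equiv> SIGMA n:{..<M}. {- int n..int n}"

definition harmonic_comb :: "nat \<Rightarrow> (nat \<times> int \<Rightarrow> complex) \<Rightarrow> S2 \<Rightarrow> complex" where
  "harmonic_comb M a \<xi> = (\<Sum>i\<in>harmonic_index M. a i * sph_Y (fst i) (snd i) \<xi>)"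

lemma harmonic_comb_mult_cnj:
  "harmonic_comb M a \<xi> * cnj (harmonic_comb M b \<xi>) =
    (\<Sum>p\<in>harmonic_index M \<times> harmonic_index M. (a (fst p) * cnj (b (snd p))) *
      (sph_Y (fst (fst p)) (snd (fst p)) \<xi> * cnj (sph_Y (fst (snd p)) (snd (snd p)) \<xi>)))"
  unfolding harmonic_comb_def cnj_sum sum_product sum.cartesian_product
  by (rule sum.cong) (auto simp: mult_ac)

lemma sum_kronecker:
  fixes a b :: "'i \<Rightarrow> complex"
  assumes "finite I"
  shows "(\<Sum>p\<in>I \<times> I. a (fst p) * cnj (b (snd p)) * (if fst p = snd p then 1 else 0)) =
    (\<Sum>i\<in>I. a i * cnj (b i))"
proof -
  have "(\<Sum>p\<in>I \<times> I. a (fst p) * cnj (b (snd p)) * (if fst p = snd p then 1 else 0)) =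
      (\<Sum>x\<in>I. \<Sum>y\<in>I. if x = y then a x * cnj (b y) else 0)"
    unfolding sum.cartesian_product by (intro sum.cong) auto
  thus ?thesis
    using assms by simp
qed

lemma sum_rotate:
  "(\<Sum>l\<in>A. \<Sum>i\<in>B. \<Sum>p\<in>C. g l i p) = (\<Sum>p\<in>C. \<Sum>l\<in>A. \<Sum>i\<in>B. g l i p)"
  by (simp only: sum.swap[where B = C])

text \<open>The value \<open>2\<close> is cancelled by the factor \<open>1 / 2\<close> that the
  spherical measure and the node weights both carry.\<close>

lemma poly_integral_normalized:
  assumes "k \<le> n" "k \<le> n'"
  shows "sqrt (2 * real n + 1) * sqrt (2 * real n' + 1) *
    poly_integral (assoc_legendre_prod n n' k) = (if n = n' then 2 else 0)"
proof (cases "n = n'")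
  case True
  define x where "x = 2 * real n + 1"
  have "x > 0"
    unfolding x_def by linarith
  hence "sqrt x * sqrt x * (2 / x) = 2"
    by simp
  thus ?thesis
    using poly_integral_assoc_legendre_prod[OF assms] True by (simp add: x_def)
qed (simp add: poly_integral_assoc_legendre_prod[OF assms])

text \<open>Orthonormality of the functions \<open>sph_Y n k\<close>, extended sesquilinearly. The
  azimuthal integral removes the pairs with \<open>k \<noteq> k'\<close>; for \<open>k = k'\<close>
  the orders agree, and the polar integral becomes that of a polynomial.\<close>

lemma sph_inner_harmonic_comb:
  "sph_inner (harmonic_comb M a) (harmonic_comb M b) = (\<Sum>i\<in>harmonic_index M. a i * cnj (b i))"
proof -
  let ?I = "harmonic_index M"
  define u where "u = (\<lambda>((n, k), (n', k')) \<theta>. sqrt (2 * real n + 1) * sqrt (2 * real n' + 1) *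
      (assoc_legendre n (nat \<bar>k\<bar>) (cos \<theta>) * assoc_legendre n' (nat \<bar>k'\<bar>) (cos \<theta>)))"
  have cont: "continuous_on {0..pi} (u p)" for p
    unfolding u_def case_prod_unfold
    by (intro continuous_intros continuous_on_compose2[OF continuous_on_assoc_legendre[of UNIV]]) auto
  have "sph_inner (harmonic_comb M a) (harmonic_comb M b) =
    (\<Sum>p\<in>?I \<times> ?I. (a (fst p) * cnj (b (snd p))) *
       (if snd (fst p) - snd (snd p) = 0 then of_real ((LBINT \<theta>:{0..pi}. u p \<theta> * sin \<theta>) / 2) else 0))"
    unfolding sph_inner_def harmonic_comb_mult_cnj
    by (rule sph_integral_separable[where u = u])
       (auto simp: sph_Y_mult_cnj u_def case_prod_unfold intro: cont[unfolded u_def case_prod_unfold])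
  also have "\<dots> = (\<Sum>p\<in>?I \<times> ?I. (a (fst p) * cnj (b (snd p))) * (if fst p = snd p then 1 else 0))"
  proof (intro sum.cong refl arg_cong[where f = "\<lambda>t. _ * t"], goal_cases)
    case (1 p)
    obtain n k n' k' where p: "p = ((n, k), (n', k'))"
      by (metis surj_pair)
    show ?case
    proof (cases "k = k'")
      case True
      have le: "nat \<bar>k\<bar> \<le> n" "nat \<bar>k\<bar> \<le> n'"
        using 1 True by (auto simp: p)
      have "(LBINT \<theta>:{0..pi}. u p \<theta> * sin \<theta>) =
          (LBINT \<theta>:{0..pi}. sqrt (2 * real n + 1) * sqrt (2 * real n' + 1) *
            (poly (assoc_legendre_prod n n' (nat \<bar>k\<bar>)) (cos \<theta>) * sin \<theta>))"
        by (intro set_lebesgue_integral_cong)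
           (auto simp: p u_def True poly_assoc_legendre_prod)
      also have "\<dots> = (if n = n' then 2 else 0)"
        unfolding set_integral_mult_right set_integral_poly_cos poly_integral_normalized[OF le] ..
      finally show ?thesis
        using True by (simp add: p)
    qed (simp add: p)
  qed
  also have "\<dots> = (\<Sum>i\<in>?I. a i * cnj (b i))"
    by (rule sum_kronecker) simp
  finally show ?thesis .
qed

lemma sph_Y_node:
  assumes "l \<in> {1..N}"
  shows "sph_Y n k (node N l i) * cnj (sph_Y n' k' (node N l i)) =
    of_real (sqrt (2 * real n + 1) * sqrt (2 * real n' + 1) *
      (assoc_legendre n (nat \<bar>k\<bar>) (legendre_root N l) * assoc_legendre n' (nat \<bar>k'\<bar>) (legendre_root N l))) *
    exp (\<i> * of_int (k - k') * of_real (2 * pi * real i / (2 * real N + 1)))"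
  unfolding node_def using legendre_root[OF assms]
  by (subst sph_Y_mult_cnj) (simp_all add: arccos_lbound arccos_ubound)

text \<open>As on the sphere, the sum over \<open>i\<close> removes the pairs with
  \<open>k \<noteq> k'\<close>. For \<open>k = k'\<close> the degree is at most
  \<open>n + n' \<le> 2 * N - 2\<close>, within the range of Gauss quadrature.\<close>

lemma disc_integral_sph_Y:
  assumes "(n, k) \<in> harmonic_index N" "(n', k') \<in> harmonic_index N"
  shows "disc_integral N (\<lambda>\<xi>. sph_Y n k \<xi> * cnj (sph_Y n' k' \<xi>)) =
    (if (n, k) = (n', k') then 1 else 0)"
proof -
  define s where "s = sqrt (2 * real n + 1) * sqrt (2 * real n' + 1)"
  define v where "v = (\<lambda>l. assoc_legendre n (nat \<bar>k\<bar>) (legendre_root N l) *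
    assoc_legendre n' (nat \<bar>k'\<bar>) (legendre_root N l))"
  have "disc_integral N (\<lambda>\<xi>. sph_Y n k \<xi> * cnj (sph_Y n' k' \<xi>)) =
    (\<Sum>l = 1..N. of_real (node_weight N l * (s * v l)) *
      (\<Sum>i = 0..2*N. exp (\<i> * of_int (k - k') * of_real (2 * pi * real i / (2 * real N + 1)))))"
    unfolding disc_integral_def sum_distrib_left
    by (intro sum.cong refl) (simp add: sph_Y_node s_def v_def mult_ac)
  also have "\<dots> = (\<Sum>l = 1..N. of_real (node_weight N l * (s * v l)) *
      (if k - k' = 0 then 2 * of_nat N + 1 else 0))"
    using assms by (subst sum_exp_nodes) auto
  also have "\<dots> = (if (n, k) = (n', k') then 1 else 0)"
  proof (cases "k = k'")
    case True
    define p where "p = assoc_legendre_prod n n' (nat \<bar>k\<bar>)"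
    have le: "nat \<bar>k\<bar> \<le> n" "nat \<bar>k\<bar> \<le> n'"
      using assms True by auto
    have "2 * real N + 1 \<noteq> 0"
      by linarith
    hence w: "node_weight N l * (2 * real N + 1) = gauss_weight N l / 2" for l
      by (simp add: node_weight_def field_simps)
    have "(\<Sum>l = 1..N. of_real (node_weight N l * (s * v l)) * (2 * of_nat N + 1)) =
        complex_of_real (\<Sum>l = 1..N. s * (gauss_weight N l / 2 * v l))"
      unfolding w[symmetric] by (simp add: mult_ac)
    also have "(\<Sum>l = 1..N. s * (gauss_weight N l / 2 * v l)) =
        s / 2 * (\<Sum>l = 1..N. gauss_weight N l * poly p (legendre_root N l))"
      unfolding sum_distrib_left v_def p_def
      by (intro sum.cong refl) (use True legendre_root in \<open>auto simp: poly_assoc_legendre_prod less_imp_le\<close>)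
    also have "\<dots> = s / 2 * poly_integral p"
      unfolding p_def using degree_assoc_legendre_prod_le[OF le] assms
      by (subst gauss_quadrature) auto
    also have "\<dots> = (if n = n' then 1 else 0)"
      using poly_integral_normalized[OF le] unfolding s_def p_def by auto
    finally show ?thesis
      using True by simp
  qed simp
  finally show ?thesis .
qed

lemma disc_inner_harmonic_comb:
  assumes "M \<le> N"
  shows "disc_inner N (harmonic_comb M a) (harmonic_comb M b) =
    (\<Sum>i\<in>harmonic_index M. a i * cnj (b i))"
proof -
  let ?I = "harmonic_index M"
  have sub: "?I \<subseteq> harmonic_index N"
    using assms by auto
  have "disc_inner N (harmonic_comb M a) (harmonic_comb M b) =
    (\<Sum>p\<in>?I \<times> ?I. (a (fst p) * cnj (b (snd p))) *
      disc_integral N (\<lambda>\<xi>. sph_Y (fst (fst p)) (snd (fst p)) \<xi> * cnj (sph_Y (fst (snd p)) (snd (snd p)) \<xi>)))"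
    unfolding disc_inner_def harmonic_comb_mult_cnj disc_integral_def sum_distrib_right sum_distrib_left
      sum_rotate[where C = "?I \<times> ?I"]
    by (simp add: mult_ac)
  also have "\<dots> = (\<Sum>p\<in>?I \<times> ?I. (a (fst p) * cnj (b (snd p))) * (if fst p = snd p then 1 else 0))"
  proof (intro sum.cong refl arg_cong[where f = "\<lambda>t. _ * t"], goal_cases)
    case (1 p)
    hence "(fst (fst p), snd (fst p)) \<in> harmonic_index N" "(fst (snd p), snd (snd p)) \<in> harmonic_index N"
      using sub by auto
    from disc_integral_sph_Y[OF this] show ?case
      by simp
  qed
  also have "\<dots> = (\<Sum>i\<in>?I. a i * cnj (b i))"
    by (rule sum_kronecker) simp
  finally show ?thesis .
qed

section \<open>The reproducing kernel\<close>

lemma sum_fun_apply: "(\<Sum>i\<in>I. f i) x = (\<Sum>i\<in>I. f i x)"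
  for f :: "'i \<Rightarrow> 'a \<Rightarrow> 'b :: comm_monoid_add"
  by (induction I rule: infinite_finite_induct) simp_all

lemma harmonic_comb_in_harmonic_space: "harmonic_comb M a \<in> harmonic_space M"
proof -
  define h where "h = (\<lambda>n. \<Sum>k = - int n..int n. (\<lambda>\<xi>. a (n, k) * sph_Y n k \<xi>))"
  have "h n \<in> sph_harmonics n" for n
    unfolding h_def sph_harmonics_def
    by (intro cfun.span_sum cfun.span_scale cfun.span_base) auto
  moreover have "harmonic_comb M a = (\<Sum>n<M. h n)"
    by (simp add: fun_eq_iff harmonic_comb_def h_def sum_fun_apply sum.Sigma case_prod_unfold)
  ultimately show ?thesis
    unfolding harmonic_space_def by blast
qed

lemma sph_harmonics_imp_sum:
  assumes "f \<in> sph_harmonics n"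
  shows "\<exists>a. f = (\<lambda>\<xi>. \<Sum>k = - int n..int n. a k * sph_Y n k \<xi>)"
  using assms unfolding sph_harmonics_def
proof (induction rule: cfun.span_induct_alt)
  case base
  show ?case
    by (intro exI[of _ "\<lambda>_. 0"]) (simp add: fun_eq_iff)
next
  case (step c g f)
  obtain k where k: "g = sph_Y n k" "k \<in> {- int n..int n}"
    using step(1) by auto
  obtain a where a: "f = (\<lambda>\<xi>. \<Sum>k = - int n..int n. a k * sph_Y n k \<xi>)"
    using step by blast
  have "c * sph_Y n k \<xi> = (\<Sum>j = - int n..int n. (if j = k then c else 0) * sph_Y n j \<xi>)" for \<xi>
    using k by (simp add: if_distrib[of "\<lambda>t. t * _"] cong: if_cong)
  thus ?case
    unfolding k a
    by (intro exI[of _ "\<lambda>j. (if j = k then c else 0) + a j"])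
       (simp add: fun_eq_iff distrib_right sum.distrib)
qed

lemma harmonic_space_eq: "harmonic_space M = range (harmonic_comb M)"
proof (intro equalityI subsetI)
  fix f assume "f \<in> harmonic_space M"
  then obtain h where h: "f = (\<Sum>n<M. h n)" "\<forall>n<M. h n \<in> sph_harmonics n"
    unfolding harmonic_space_def by blast
  have "\<forall>n. \<exists>a. n < M \<longrightarrow> h n = (\<lambda>\<xi>. \<Sum>k = - int n..int n. a k * sph_Y n k \<xi>)"
    using h(2) sph_harmonics_imp_sum by blast
  then obtain a where a: "\<And>n. n < M \<Longrightarrow> h n = (\<lambda>\<xi>. \<Sum>k = - int n..int n. a n k * sph_Y n k \<xi>)"
    by metis
  have "f = harmonic_comb M (\<lambda>(n, k). a n k)"
    unfolding h(1)
    by (simp add: fun_eq_iff harmonic_comb_def sum_fun_apply a sum.Sigma case_prod_unfold)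
  thus "f \<in> range (harmonic_comb M)"
    by blast
qed (auto simp: harmonic_comb_in_harmonic_space)

lemma subspace_harmonic_space: "cfun.subspace (harmonic_space M)"
  unfolding harmonic_space_eq
proof (rule cfun.subspaceI)
  have "0 = harmonic_comb M (\<lambda>_. 0)"
    by (simp add: fun_eq_iff harmonic_comb_def)
  thus "0 \<in> range (harmonic_comb M)"
    by blast
next
  fix f g assume "f \<in> range (harmonic_comb M)" "g \<in> range (harmonic_comb M)"
  then obtain a b where "f = harmonic_comb M a" "g = harmonic_comb M b"
    by blast
  hence "f + g = harmonic_comb M (\<lambda>i. a i + b i)"
    by (simp add: fun_eq_iff harmonic_comb_def distrib_right sum.distrib)
  thus "f + g \<in> range (harmonic_comb M)"
    by blast
next
  fix c f assume "f \<in> range (harmonic_comb M)"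
  then obtain a where "f = harmonic_comb M a"
    by blast
  hence "(\<lambda>\<xi>. c * f \<xi>) = harmonic_comb M (\<lambda>i. c * a i)"
    by (simp add: fun_eq_iff harmonic_comb_def sum_distrib_left mult_ac)
  thus "(\<lambda>\<xi>. c * f \<xi>) \<in> range (harmonic_comb M)"
    by blast
qed

section \<open>The kernel and its extremal property\<close>

lemma scaling_fun_eq:
  "(\<lambda>\<xi>. scaling_fun M \<xi> \<eta>) = harmonic_comb M (\<lambda>i. cnj (sph_Y (fst i) (snd i) \<eta>))"
  by (simp add: fun_eq_iff scaling_fun_def harmonic_comb_def sum.Sigma case_prod_unfold)

lemma scaling_fun_in_harmonic_space: "(\<lambda>\<xi>. scaling_fun M \<xi> \<eta>) \<in> harmonic_space M"
  unfolding scaling_fun_eq by (rule harmonic_comb_in_harmonic_space)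

lemma cnj_scaling_fun: "cnj (scaling_fun M \<xi> \<eta>) = scaling_fun M \<eta> \<xi>"
  by (simp add: scaling_fun_def mult.commute)

text \<open>The kernel centred at \<open>\<eta>\<close> has the conjugated basis values at
  \<open>\<eta>\<close> as coordinates. The scalar product conjugates them back, so the sum is the
  expansion of \<open>f\<close> evaluated at \<open>\<eta>\<close>.\<close>

lemma sph_inner_scaling_fun:
  assumes "f \<in> harmonic_space M"
  shows "sph_inner f (\<lambda>\<xi>. scaling_fun M \<xi> \<eta>) = f \<eta>"
  using assms unfolding scaling_fun_eq harmonic_space_eq
  by (auto simp: sph_inner_harmonic_comb) (simp add: harmonic_comb_def)

text \<open>In coordinates both scalar products are the same sum; this carries the identities on the
  sphere over to the nodes.\<close>

lemma disc_inner_eq_sph_inner: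
  assumes "M \<le> N" "f \<in> harmonic_space M" "g \<in> harmonic_space M"
  shows "disc_inner N f g = sph_inner f g"
  using assms unfolding harmonic_space_eq
  by (auto simp: sph_inner_harmonic_comb disc_inner_harmonic_comb)

lemma disc_inner_scaling_fun:
  assumes "M \<le> N" "f \<in> harmonic_space M"
  shows "disc_inner N f (\<lambda>\<xi>. scaling_fun M \<xi> \<eta>) = f \<eta>"
  unfolding disc_inner_eq_sph_inner[OF assms scaling_fun_in_harmonic_space]
  by (rule sph_inner_scaling_fun[OF assms(2)])

text \<open>The exponentials have modulus one, so by \<open>sum_assoc_legendre_squares\<close> the
  degree \<open>n\<close> contributes \<open>2 * n + 1\<close>; the first \<open>M\<close> odd
  numbers add up to the square of \<open>M\<close>.\<close>

lemma scaling_fun_diagonal: "scaling_fun M \<eta> \<eta> = of_nat (M\<^sup>2)"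
proof -
  have "(\<Sum>k = - int n..int n. cnj (sph_Y n k \<eta>) * sph_Y n k \<eta>) = of_nat (2 * n + 1)" for n
  proof -
    define x where "x = cos (polar \<eta>)"
    have "cnj (sph_Y n k \<eta>) * sph_Y n k \<eta> =
        of_real ((2 * real n + 1) * (assoc_legendre n (nat \<bar>k\<bar>) x)\<^sup>2)" for k
    proof -
      have "norm (exp (\<i> * of_int k * of_real (azimuth \<eta>))) = 1"
        by simp
      hence "norm (sph_Y n k \<eta>) = sqrt (2 * real n + 1) * \<bar>assoc_legendre n (nat \<bar>k\<bar>) x\<bar>"
        unfolding sph_Y_def x_def norm_mult norm_of_real by (simp add: abs_mult)
      hence "(norm (sph_Y n k \<eta>))\<^sup>2 = (2 * real n + 1) * (assoc_legendre n (nat \<bar>k\<bar>) x)\<^sup>2"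
        by (simp add: power_mult_distrib)
      thus ?thesis
        using complex_norm_square[of "sph_Y n k \<eta>"] by (simp add: mult.commute)
    qed
    hence "(\<Sum>k = - int n..int n. cnj (sph_Y n k \<eta>) * sph_Y n k \<eta>) =
        of_real ((2 * real n + 1) * (\<Sum>k = - int n..int n. (assoc_legendre n (nat \<bar>k\<bar>) x)\<^sup>2))"
      unfolding sum_distrib_left by simp
    also have "(\<Sum>k = - int n..int n. (assoc_legendre n (nat \<bar>k\<bar>) x)\<^sup>2) = 1"
      by (rule sum_assoc_legendre_squares) (simp_all add: x_def)
    finally show ?thesis
      by simp
  qed
  hence "scaling_fun M \<eta> \<eta> = of_nat (\<Sum>n<M. 2 * n + 1)"
    unfolding scaling_fun_def by simp
  also have "(\<Sum>n<M. 2 * n + 1) = M\<^sup>2"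
    by (induction M) (simp_all add: power2_eq_square)
  finally show ?thesis .
qed

lemma sph_inner_self:
  assumes "f \<in> harmonic_space M"
  shows "sph_inner f f = of_real ((sph_norm f)\<^sup>2)"
proof -
  obtain a where "f = harmonic_comb M a"
    using assms unfolding harmonic_space_eq by blast
  hence "sph_inner f f = of_real (\<Sum>i\<in>harmonic_index M. (cmod (a i))\<^sup>2)"
    by (simp add: sph_inner_harmonic_comb complex_norm_square del: of_real_power)
  thus ?thesis
    unfolding sph_norm_def by (simp add: sum_nonneg)
qed

text \<open>In coordinates the norms are Euclidean norms of the coefficients, which reduces the
  inequality to finite sums.\<close>

lemma sph_inner_cauchy_schwarz:
  assumes "f \<in> harmonic_space M" "g \<in> harmonic_space M"
  shows "cmod (sph_inner f g) \<le> sph_norm f * sph_norm g"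
proof -
  let ?I = "harmonic_index M"
  obtain a b where ab: "f = harmonic_comb M a" "g = harmonic_comb M b"
    using assms unfolding harmonic_space_eq by blast
  have norm: "sph_norm (harmonic_comb M c) = L2_set (\<lambda>i. cmod (c i)) ?I" for c
  proof -
    have "sph_inner (harmonic_comb M c) (harmonic_comb M c) = of_real (\<Sum>i\<in>?I. (cmod (c i))\<^sup>2)"
      by (simp add: sph_inner_harmonic_comb complex_norm_square del: of_real_power)
    thus ?thesis
      unfolding sph_norm_def L2_set_def by (simp only: Re_complex_of_real)
  qed
  have "cmod (sph_inner f g) \<le> (\<Sum>i\<in>?I. \<bar>cmod (a i)\<bar> * \<bar>cmod (b i)\<bar>)"
    unfolding ab sph_inner_harmonic_comb by (rule order_trans[OF norm_sum]) (simp add: norm_mult)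
  also have "\<dots> \<le> sph_norm f * sph_norm g"
    unfolding ab norm by (rule L2_set_mult_ineq)
  finally show ?thesis .
qed

text \<open>By the reproducing property the squared norm is the diagonal value.\<close>

lemma sph_norm_scaling_fun: "sph_norm (\<lambda>\<xi>. scaling_fun M \<xi> \<eta>) = real M"
  unfolding sph_norm_def sph_inner_scaling_fun[OF scaling_fun_in_harmonic_space]
  by (simp add: scaling_fun_diagonal)

lemma sph_inner_scale_right:
  "sph_inner f (\<lambda>\<xi>. of_real c * g \<xi>) = of_real c * sph_inner f g"
proof -
  have "sph_integral (\<lambda>\<xi>. of_real c * F \<xi>) = of_real c * sph_integral F" for F
    unfolding sph_integral_def mult.assoc set_integral_mult_right by (simp only: mult_ac)
  from this[of "\<lambda>\<xi>. f \<xi> * cnj (g \<xi>)"] show ?thesis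
    by (simp add: sph_inner_def mult_ac)
qed

text \<open>The kernel divided by its diagonal value attains the bound. The bound itself comes from
  writing \<open>f \<eta>\<close> as a scalar product with the kernel, whose norm is
  \<open>M\<close>.\<close>

lemma harmonic_space_localization:
  assumes "M > 0"
  shows "is_minimum (1 / real M) {sph_norm f | f. f \<in> harmonic_space M \<and> f \<eta> = 1}"
  unfolding is_minimum_def
proof (intro conjI ballI)
  define f where "f = (\<lambda>\<xi>. of_real (1 / (real M)\<^sup>2) * scaling_fun M \<xi> \<eta>)"
  have f: "f \<in> harmonic_space M"
    unfolding f_def
    by (rule cfun.subspace_scale[OF subspace_harmonic_space scaling_fun_in_harmonic_space])
  have f_\<eta>: "f \<eta> = 1"
    using assms by (simp add: f_def scaling_fun_diagonal)
  \<comment> \<open>Only the second argument is expanded, so that the reproducing property evaluates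
    the first one at \<open>\<eta>\<close>.\<close>
  have "sph_inner f f = of_real (1 / (real M)\<^sup>2) * sph_inner f (\<lambda>\<xi>. scaling_fun M \<xi> \<eta>)"
    by (subst (2) f_def) (rule sph_inner_scale_right)
  hence "sph_inner f f = of_real (1 / (real M)\<^sup>2)"
    by (simp add: sph_inner_scaling_fun[OF f] f_\<eta>)
  hence "sph_norm f = 1 / real M"
    unfolding sph_norm_def by (simp add: real_sqrt_divide del: of_real_divide)
  thus "1 / real M \<in> {sph_norm f | f. f \<in> harmonic_space M \<and> f \<eta> = 1}"
    using f f_\<eta> by force
next
  fix s assume "s \<in> {sph_norm f | f. f \<in> harmonic_space M \<and> f \<eta> = 1}"
  then obtain f where f: "s = sph_norm f" "f \<in> harmonic_space M" "f \<eta> = 1"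
    by blast
  have "1 \<le> sph_norm f * real M"
    using sph_inner_cauchy_schwarz[OF f(2) scaling_fun_in_harmonic_space[of M \<eta>]] f
    by (simp add: sph_inner_scaling_fun sph_norm_scaling_fun)
  thus "1 / real M \<le> s"
    using assms f(1) by (simp add: field_simps)
qed

section \<open>Expansion in kernels at the nodes, span and tight frame\<close>

lemma discrete_expansion:
  assumes "M \<le> N" "f \<in> harmonic_space M"
  shows "f = (\<Sum>l = 1..N. \<Sum>i = 0..2*N.
    (\<lambda>\<xi>. (f (node N l i) * of_real (node_weight N l)) * scaling_fun M \<xi> (node N l i)))"
proof
  fix \<xi>
  \<comment> \<open>The discrete reproducing property is used at an arbitrary point
    \<open>\<xi>\<close>, not only at a node. Hermitian symmetry then puts the nodes into the second
    argument of the kernel.\<close>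
  have "f \<xi> = disc_inner N f (\<lambda>\<zeta>. scaling_fun M \<zeta> \<xi>)"
    by (rule disc_inner_scaling_fun[OF assms, symmetric])
  also have "\<dots> = (\<Sum>l = 1..N. \<Sum>i = 0..2*N.
      f (node N l i) * of_real (node_weight N l) * scaling_fun M \<xi> (node N l i))"
    unfolding disc_inner_def disc_integral_def cnj_scaling_fun by (simp only: mult_ac)
  finally show "f \<xi> = (\<Sum>l = 1..N. \<Sum>i = 0..2*N.
    (\<lambda>\<xi>. (f (node N l i) * of_real (node_weight N l)) * scaling_fun M \<xi> (node N l i))) \<xi>"
    unfolding sum_fun_apply .
qed

lemma span_scaling_fun:
  assumes "M \<le> N"
  shows "cfun.span {(\<lambda>\<xi>. scaling_fun M \<xi> \<eta>) | \<eta>. \<eta> \<in> nodes N} = harmonic_space M"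
proof
  show "cfun.span {(\<lambda>\<xi>. scaling_fun M \<xi> \<eta>) | \<eta>. \<eta> \<in> nodes N} \<subseteq> harmonic_space M"
    by (rule cfun.span_minimal[OF _ subspace_harmonic_space]) (auto simp: scaling_fun_in_harmonic_space)
  show "harmonic_space M \<subseteq> cfun.span {(\<lambda>\<xi>. scaling_fun M \<xi> \<eta>) | \<eta>. \<eta> \<in> nodes N}"
  proof
    fix f assume "f \<in> harmonic_space M"
    have "(\<lambda>\<xi>. scaling_fun M \<xi> (node N l i)) \<in> {(\<lambda>\<xi>. scaling_fun M \<xi> \<eta>) | \<eta>. \<eta> \<in> nodes N}"
      if "l \<in> {1..N}" "i \<in> {0..2*N}" for l i
      using that unfolding nodes_def by blast
    thus "f \<in> cfun.span {(\<lambda>\<xi>. scaling_fun M \<xi> \<eta>) | \<eta>. \<eta> \<in> nodes N}"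
      by (subst discrete_expansion[OF assms \<open>f \<in> harmonic_space M\<close>])
         (intro cfun.span_sum cfun.span_scale cfun.span_base)
  qed
qed

text \<open>The squared norm equals its discrete counterpart, in which the values
  \<open>f (node N l i)\<close> are scalar products with the kernels by the reproducing
  property.\<close>

lemma sph_norm_eq_discrete:
  assumes "M \<le> N" "f \<in> harmonic_space M"
  shows "(sph_norm f)\<^sup>2 = (\<Sum>l = 1..N. \<Sum>i = 0..2*N. node_weight N l *
    (cmod (sph_inner f (\<lambda>\<xi>. scaling_fun M \<xi> (node N l i))))\<^sup>2)"
proof -
  have "complex_of_real ((sph_norm f)\<^sup>2) = disc_inner N f f"
    unfolding disc_inner_eq_sph_inner[OF assms(1,2,2)] sph_inner_self[OF assms(2)] ..
  also have "\<dots> = of_real (\<Sum>l = 1..N. \<Sum>i = 0..2*N. node_weight N l * (cmod (f (node N l i)))\<^sup>2)"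
    by (simp add: disc_inner_def disc_integral_def complex_norm_square mult_ac del: of_real_power)
  finally show ?thesis
    unfolding of_real_eq_iff by (simp add: sph_inner_scaling_fun[OF assms(2)])
qed

lemma node_weight_nonneg:
  assumes "l \<in> {1..N}"
  shows "node_weight N l \<ge> 0"
  using gauss_weight_nonneg[OF assms] by (simp add: node_weight_def)

text \<open>The frame bound is \<open>1\<close>: the square roots of the weights are squared back,
  which uses that the weights are nonnegative.\<close>

lemma tight_frame_scaling_fun:
  assumes "M \<le> N"
  shows "tight_frame (harmonic_space M) ({1..N} \<times> {0..2*N})
    (\<lambda>(l, i) \<xi>. of_real (sqrt (node_weight N l)) * scaling_fun M \<xi> (node N l i))"
  unfolding tight_frame_def
proof (intro conjI ballI exI[of _ "1 :: real"])
  fix p :: "nat \<times> nat"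
  show "(case p of (l, i) \<Rightarrow> \<lambda>\<xi>. of_real (sqrt (node_weight N l)) * scaling_fun M \<xi> (node N l i))
      \<in> harmonic_space M"
    by (cases p) (auto intro: cfun.subspace_scale[OF subspace_harmonic_space scaling_fun_in_harmonic_space])
next
  fix f assume f: "f \<in> harmonic_space M"
  have "(\<Sum>p\<in>{1..N} \<times> {0..2*N}. (cmod (sph_inner f
      (case p of (l, i) \<Rightarrow> \<lambda>\<xi>. of_real (sqrt (node_weight N l)) * scaling_fun M \<xi> (node N l i))))\<^sup>2) =
    (\<Sum>l = 1..N. \<Sum>i = 0..2*N. node_weight N l *
      (cmod (sph_inner f (\<lambda>\<xi>. scaling_fun M \<xi> (node N l i))))\<^sup>2)"
    unfolding sum.cartesian_product
    by (intro sum.cong)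
       (auto simp: sph_inner_scale_right norm_mult power_mult_distrib node_weight_nonneg)
  thus "(\<Sum>p\<in>{1..N} \<times> {0..2*N}. (cmod (sph_inner f
      (case p of (l, i) \<Rightarrow> \<lambda>\<xi>. of_real (sqrt (node_weight N l)) * scaling_fun M \<xi> (node N l i))))\<^sup>2) =
    1 * (sph_norm f)\<^sup>2"
    using sph_norm_eq_discrete[OF assms f] by simp
qed simp_all

text \<open>The constant is \<open>sph_Y 0 0\<close>, and \<open>M > 0\<close> puts degree
  \<open>0\<close> among the summands. Mean values can then be read as scalar products with
  \<open>1\<close>.\<close>

lemma one_in_harmonic_space:
  assumes "M > 0"
  shows "(\<lambda>_. 1) \<in> harmonic_space M"
proof -
  have "sph_Y 0 0 \<xi> = 1" for \<xi>
    by (simp add: sph_Y_def assoc_legendre_def legendre_def)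
  moreover have "harmonic_comb M (\<lambda>i. if i = (0, 0) then 1 else 0) = sph_Y 0 0"
    using assms
    by (simp add: fun_eq_iff harmonic_comb_def if_distrib[of "\<lambda>t. t * _"] cong: if_cong)
  ultimately have "(\<lambda>_. 1) = harmonic_comb M (\<lambda>i. if i = (0, 0) then 1 else 0)"
    by (simp add: fun_eq_iff)
  thus ?thesis
    by (simp add: harmonic_comb_in_harmonic_space)
qed

text \<open>Pairing the constant with the kernel evaluates it at \<open>\<eta>\<close>; exchanging
  the arguments only conjugates the value \<open>1\<close>.\<close>

lemma sph_inner_scaling_fun_1:
  assumes "M > 0"
  shows "sph_inner (\<lambda>\<xi>. scaling_fun M \<xi> \<eta>) (\<lambda>_. 1) = 1"
proof -
  obtain b where b: "(\<lambda>_. 1) = harmonic_comb M b"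
    using one_in_harmonic_space[OF assms] unfolding harmonic_space_eq by blast
  have "sph_inner (\<lambda>\<xi>. scaling_fun M \<xi> \<eta>) (\<lambda>_. 1) = cnj (harmonic_comb M b \<eta>)"
    unfolding b scaling_fun_eq sph_inner_harmonic_comb
    by (simp add: harmonic_comb_def mult.commute)
  thus ?thesis
    by (simp flip: b)
qed

theorem theorem5p2:
  fixes N j0 :: nat and m :: "nat \<Rightarrow> nat"
  assumes "N \<ge> 1"
    and "strict_mono_on {1..} m"
    and "\<forall>j\<ge>1. m j > 0"
    and "j0 \<ge> 1"
    and "\<forall>j\<ge>1. j \<le> j0 \<longrightarrow> m j \<le> N"
  shows "\<forall>j\<ge>1.
    \<comment> \<open>reproducing property\<close>
    (\<forall>\<eta>\<in>nodes N. j \<le> j0 \<longrightarrow> (\<forall>f\<in>harmonic_space (m j).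
        sph_inner f (\<lambda>\<xi>. scaling_fun (m j) \<xi> \<eta>) = f \<eta> \<and>
        disc_inner N f (\<lambda>\<xi>. scaling_fun (m j) \<xi> \<eta>) = f \<eta>)) \<and>
    \<comment> \<open>norms and diagonal values\<close>
    (\<forall>\<eta>\<in>nodes N.
        sph_norm (\<lambda>\<xi>. scaling_fun (m j) \<xi> \<eta>) = real (m j) \<and>
        scaling_fun (m j) \<eta> \<eta> = of_nat ((m j)\<^sup>2) \<and>
        (j \<le> j0 \<longrightarrow> disc_norm N (\<lambda>\<xi>. scaling_fun (m j) \<xi> \<eta>) = real (m j))) \<and>
    \<comment> \<open>localization; the quotient is formed in the complex numbers\<close>
    (\<forall>\<eta>\<in>nodes N. \<exists>r.
        is_minimum r {sph_norm f | f. f \<in> harmonic_space (m j) \<and> f \<eta> = 1} \<and>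
        of_real (sph_norm (\<lambda>\<xi>. scaling_fun (m j) \<xi> \<eta>)) / scaling_fun (m j) \<eta> \<eta> = of_real r) \<and>
    \<comment> \<open>span\<close>
    (j \<le> j0 \<longrightarrow> cfun.span {(\<lambda>\<xi>. scaling_fun (m j) \<xi> \<eta>) | \<eta>. \<eta> \<in> nodes N} = harmonic_space (m j)) \<and>
    \<comment> \<open>tight frame\<close>
    (j \<le> j0 \<longrightarrow>
        tight_frame (harmonic_space (m j)) ({1..N} \<times> {0..2*N})
          (\<lambda>(l, i) \<xi>. of_real (sqrt (node_weight N l)) * scaling_fun (m j) \<xi> (node N l i)) \<and>
        (\<forall>f\<in>harmonic_space (m j). (sph_norm f)\<^sup>2 =
          (\<Sum>l=1..N. \<Sum>i=0..2*N. node_weight N l *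
             (cmod (sph_inner f (\<lambda>\<xi>. scaling_fun (m j) \<xi> (node N l i))))\<^sup>2))) \<and>
    \<comment> \<open>mean values\<close>
    (\<forall>\<eta>\<in>nodes N.
        sph_integral (\<lambda>\<xi>. scaling_fun (m j) \<xi> \<eta>) = 1 \<and>
        (m j \<le> N \<longrightarrow> disc_integral N (\<lambda>\<xi>. scaling_fun (m j) \<xi> \<eta>) = 1))"
proof (intro allI impI, goal_cases)
  case (1 j)
  define M where "M = m j"
  have M: "M > 0"
    using assms(3) 1 by (simp add: M_def)
  have MN: "M \<le> N" if "j \<le> j0"
    using assms(5) 1 that by (simp add: M_def)
  \<comment> \<open>Of the eleven goals, 1 and 2 are the reproducing property, 3 to 5 the norms and
    the diagonal, 6 the localization, 7 the span, 8 and 9 the frame, 10 and 11 the mean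
    values.\<close>
  show ?case
    unfolding M_def[symmetric]
  proof (intro conjI ballI impI, goal_cases)
    case (1 \<eta> f)
    thus ?case
      by (simp add: sph_inner_scaling_fun)
  next
    case (2 \<eta> f)
    thus ?case
      by (simp add: disc_inner_scaling_fun MN)
  next
    case (3 \<eta>)
    show ?case
      by (rule sph_norm_scaling_fun)
  next
    case (4 \<eta>)
    show ?case
      by (rule scaling_fun_diagonal)
  next
    case (5 \<eta>)
    thus ?case
      by (simp add: disc_norm_def disc_inner_scaling_fun MN scaling_fun_in_harmonic_space scaling_fun_diagonal)
  next
    case (6 \<eta>)
    have "of_real (sph_norm (\<lambda>\<xi>. scaling_fun M \<xi> \<eta>)) / scaling_fun M \<eta> \<eta> = complex_of_real (1 / real M)"
      using M by (simp add: sph_norm_scaling_fun scaling_fun_diagonal power2_eq_square)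
    thus ?case
      using harmonic_space_localization[OF M] by blast
  next
    case 7
    thus ?case
      by (intro span_scaling_fun MN)
  next
    case 8
    thus ?case
      by (intro tight_frame_scaling_fun MN)
  next
    case (9 f)
    thus ?case
      by (intro sph_norm_eq_discrete MN)
  next
    case (10 \<eta>)
    show ?case
      using sph_inner_scaling_fun_1[OF M, of \<eta>] by (simp add: sph_inner_def)
  next
    case (11 \<eta>)
    \<comment> \<open>The bound \<open>M \<le> N\<close> is here a premise of the goal itself and
      does not come from \<open>j \<le> j0\<close>.\<close>
    have "disc_inner N (\<lambda>\<xi>. scaling_fun M \<xi> \<eta>) (\<lambda>_. 1) = 1"
      unfolding disc_inner_eq_sph_inner[OF 11(2) scaling_fun_in_harmonic_space one_in_harmonic_space[OF M]]
      by (rule sph_inner_scaling_fun_1[OF M])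
    thus ?case
      by (simp add: disc_inner_def)
  qed
qed

end
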